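(* For any $1\le i_1<i_2<\dots<i_k\le n$, $$T_{\rm rel}(n;[i_1,i_2,\dots,i_k])=T_{\rm rel}^{\rm East}(i_k-1).$$ In particular the relaxation time of the matrix walk $\{M(t)\}_{t\ge 0}$ on $\mathcal M_n$ (the case $k=n$, $(i_1,\dots,i_k)=(1,\dots,n)$) coincides with that of the East process on $[n-1]$ at density $1/2$.
   Context: $[n]=\{1,\dots,n\}$. $\mathcal M_n$ is the set of $n\times n$ upper triangular matrices over $\mathbb F_2$ with ones on the diagonal. For $1\le i_1<\dots<i_k\le n$, $\mathcal M_{[i_1,\dots,i_k]}$ is the set of $A\in\mathbb F_2^{n\times k}$ such that $A(x,j)=0$ for $x>i_j$ and $A(i_j,j)=1$ (i.e. the matrices formed by columns $i_1,\dots,i_k$ of elements of $\mathcal M_n$); $\mathcal M_{[1,\dots,n]}=\mathcal M_n$. The matrix walk on $\mathcal M_{[i_1,\dots,i_k]}$ is the continuous-time Markov chain in which, independently for each row $x\in\{1,\dots,n-1\}$, at rate one a fair Bernoulli variable $\xi\in\{0,1\}$ is sampled and row $x$ is replaced by (row $x$) $+\,\xi\cdot$(row $x+1$) mod $2$. It is ergodic and reversible with respect to the uniform measure on $\mathcal M_{[i_1,\dots,i_k]}$. $T_{\rm rel}(n;[i_1,\dots,i_k])$ is its relaxation time, i.e. the inverse of the spectral gap of its generator $\mathcal L$ (the smallest positive eigenvalue of $-\mathcal L$). The East process on $[m]$ at density $1/2$ is the continuous-time Markov chain on $\{0,1\}^m$ in which, for every $x\in[m]$, at rate one (independently over $x$)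 the spin $\sigma(x)$ is replaced by a fresh Bernoulli$(1/2)$ variable if and only if $x=1$, or $x\ge 2$ and $\sigma(x-1)=0$. It is reversible with respect to the uniform measure, and $T^{\rm East}_{\rm rel}(m)$ is its relaxation time (inverse spectral gap). When $i_k=1$ both chains have a one-point state space and their relaxation times are taken to be $0$ by convention. *)

theory Defs
  imports
    "HOL-Probability.Probability_Mass_Function"
    "HOL-Library.Z2"
    "Jordan_Normal_Form.Gauss_Jordan_Elimination"
begin

section \<open>Finite continuous-time chains driven by rate-one clocks\<close>

text \<open>
  Every index \<open>x \<in> I\<close> carries an independent rate-one clock; when it rings, the current
  state \<open>s\<close> is replaced by a sample of \<open>K x s\<close>. The state space is a finite set
  \<open>S\<close> preserved by all the kernels, and functions on \<open>S\<close> are represented by functions on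
  the whole type, of which only the values on \<open>S\<close> matter.
\<close>

definition clock_generator ::
  "'i set \<Rightarrow> ('i \<Rightarrow> 's \<Rightarrow> 's pmf) \<Rightarrow> ('s \<Rightarrow> real) \<Rightarrow> 's \<Rightarrow> real" where
  "clock_generator I K f s = (\<Sum>x\<in>I. measure_pmf.expectation (K x s) f - f s)"

definition eigenvalue_on :: "'s set \<Rightarrow> (('s \<Rightarrow> real) \<Rightarrow> 's \<Rightarrow> real) \<Rightarrow> real \<Rightarrow> bool" where
  "eigenvalue_on S T \<mu> \<longleftrightarrow> (\<exists>f. (\<exists>s\<in>S. f s \<noteq> 0) \<and> (\<forall>s\<in>S. T f s = \<mu> * f s))"

definition spectral_gap :: "'s set \<Rightarrow> (('s \<Rightarrow> real) \<Rightarrow> 's \<Rightarrow> real) \<Rightarrow> real" where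
  "spectral_gap S L = (LEAST \<mu>. 0 < \<mu> \<and> eigenvalue_on S (\<lambda>f s. - L f s) \<mu>)"

text \<open>On a one-point state space there is no positive eigenvalue; the value there is a convention.\<close>

definition relaxation_time :: "'s set \<Rightarrow> (('s \<Rightarrow> real) \<Rightarrow> 's \<Rightarrow> real) \<Rightarrow> real" where
  "relaxation_time S L = (if card S = 1 then 0 else 1 / spectral_gap S L)"

definition fair_bit :: "bit pmf" where
  "fair_bit = map_pmf of_bool (bernoulli_pmf (1 / 2))"


section \<open>The matrix walk\<close>

text \<open>
  Rows, columns and the column indices \<open>i\<^sub>1 < \<dots> < i\<^sub>k\<close> (given as a list \<open>cs\<close>) are numbered
  from 1 in the mathematics, whereas matrix entries and list positions are accessed from 0:
  the entry in row \<open>x\<close> and column \<open>j\<close> is \<open>A $$ (x - 1, j - 1)\<close>, and \<open>i\<^sub>j\<close> is \<open>cs ! (j - 1)\<close>.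
\<close>

definition unitriangular :: "nat \<Rightarrow> bit mat set" where
  "unitriangular n =
     {A \<in> carrier_mat n n. upper_triangular A \<and> (\<forall>x\<in>{1..n}. A $$ (x - 1, x - 1) = 1)}"

definition column_matrices :: "nat \<Rightarrow> nat list \<Rightarrow> bit mat set" where
  "column_matrices n cs =
     {A \<in> carrier_mat n (length cs).
        \<forall>j\<in>{1..length cs}.
          (\<forall>x\<in>{1..n}. x > cs ! (j - 1) \<longrightarrow> A $$ (x - 1, j - 1) = 0) \<and>
          A $$ (cs ! (j - 1) - 1, j - 1) = 1}"

lemma column_matrices_all: "column_matrices n [1..<Suc n] = unitriangular n"
proof (intro equalityI subsetI)
  fix A assume A: "A \<in> column_matrices n [1..<Suc n]"
  then have d: "A \<in> carrier_mat n n" by (simp add: column_matrices_def del: upt_Suc)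
  have zero: "A $$ (x - 1, j - 1) = 0" if "x \<in> {1..n}" "j \<in> {1..n}" "x > j" for x j
    using A that by (auto simp: column_matrices_def simp del: upt_Suc)
  have one: "A $$ (j - 1, j - 1) = 1" if "j \<in> {1..n}" for j
    using A that by (auto simp: column_matrices_def simp del: upt_Suc)
  have "upper_triangular A"
  proof
    fix i j assume "j < i" "i < dim_row A"
    then show "A $$ (i, j) = 0" using zero[of "Suc i" "Suc j"] d by auto
  qed
  then show "A \<in> unitriangular n" using d one by (simp add: unitriangular_def)
next
  fix A assume "A \<in> unitriangular n"
  then show "A \<in> column_matrices n [1..<Suc n]"
    by (auto simp: unitriangular_def column_matrices_def upper_triangular_def simp del: upt_Suc)
qed

text \<open>\<open>addrow \<xi> (x - 1) x\<close> adds \<open>\<xi>\<close> times row \<open>x + 1\<close> to row \<open>x\<close> (rows numbered from 1).\<close>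

definition row_update :: "nat \<Rightarrow> bit mat \<Rightarrow> bit mat pmf" where
  "row_update x A = map_pmf (\<lambda>\<xi>. addrow \<xi> (x - 1) x A) fair_bit"

definition matrix_walk_generator :: "nat \<Rightarrow> (bit mat \<Rightarrow> real) \<Rightarrow> bit mat \<Rightarrow> real" where
  "matrix_walk_generator n = clock_generator {1..<n} row_update"

definition T_rel :: "nat \<Rightarrow> nat list \<Rightarrow> real" where
  "T_rel n cs = relaxation_time (column_matrices n cs) (matrix_walk_generator n)"


section \<open>The East process at density 1/2\<close>

definition east_configs :: "nat \<Rightarrow> (nat \<Rightarrow> bit) set" where
  "east_configs m = {1..m} \<rightarrow>\<^sub>E {0, 1}"

definition east_update :: "nat \<Rightarrow> (nat \<Rightarrow> bit) \<Rightarrow> (nat \<Rightarrow> bit) pmf" where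
  "east_update x \<sigma> =
     (if x = 1 \<or> (x \<ge> 2 \<and> \<sigma> (x - 1) = 0) then map_pmf (\<lambda>b. \<sigma>(x := b)) fair_bit
      else return_pmf \<sigma>)"

definition east_generator :: "nat \<Rightarrow> ((nat \<Rightarrow> bit) \<Rightarrow> real) \<Rightarrow> (nat \<Rightarrow> bit) \<Rightarrow> real" where
  "east_generator m = clock_generator {1..m} east_update"

definition T_rel_East :: "nat \<Rightarrow> real" where
  "T_rel_East m = relaxation_time (east_configs m) (east_generator m)"

end

theory Submission
  imports Defs "HOL-Analysis.Function_Topology"
begin

text \<open>
  Both generators have the same form: \<open>- \<L> f s = (\<Sum>x. (f s - f (t x s)) / 2)\<close> for involutions \<open>t x\<close> of a
  finite set, which are adding row \<open>x + 1\<close> to row \<open>x\<close> for the matrices, and flipping a facilitated spin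
  for the East process. The two relaxation times agree because the positive eigenvalues of the East
  process on \<open>[i\<^sub>k - 1]\<close> are eigenvalues of the matrix walk, and each positive eigenvalue of the matrix
  walk is bounded below by one of these.

  The inclusion holds because a sum of columns evolves on its own: row \<open>x\<close> of the sum is refreshed
  exactly when row \<open>x + 1\<close> of the sum equals 1. Read upwards from its lowest 1, which never changes,
  and with 0 and 1 exchanged, it is an East configuration (\<open>spins_row_add\<close>). Functions of the last
  column alone therefore carry the whole East spectrum (\<open>east_eigenvalue_of_walk\<close>).

  For the bound, let \<open>\<mu>\<close> be a positive eigenvalue of the matrix walk. Flipping an entry in row \<open>i\<close>
  commutes with the generator on the functions that do not see the rows above \<open>i\<close>. Diagonalising these
  flips row by row gives an eigenfunction \<open>g\<close> that does not see the rows above some row \<open>i\<close> and is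
  multiplied by a nontrivial character, with support \<open>b\<close>, when row \<open>i\<close> is translated
  (\<open>obtain_sign_character\<close>). Let \<open>u\<close> be the sum of the columns in \<open>b\<close>. The move of row \<open>i\<close> changes the
  sign of \<open>g\<close> exactly when \<open>u\<close> has a 1 in row \<open>i + 1\<close>, so on \<open>g\<close> it acts as a killing which depends on
  the matrix through \<open>u\<close> only. Hence the maximum \<open>\<psi>\<close> of \<open>\<bar>g\<bar>\<close> over the matrices with a given East
  configuration is a subsolution for the killed East process: at a maximising matrix all moves
  compare the right way. Giving \<open>\<psi>\<close> the sign of the last spin turns it into a function of mean zero
  whose Rayleigh quotient for the East process is at most \<open>\<mu>\<close> (\<open>east_eigenvalue_below\<close>). As the
  East process is irreducible, the minimum of the Rayleigh quotient over mean-zero functions is a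
  positive eigenvalue (\<open>eigenvalue_below_rayleigh_quotient\<close>). The East process so obtained may be
  shorter than \<open>i\<^sub>k - 1\<close>, but the first spins of an East process form an East process
  (\<open>east_eigenvalue_mono\<close>).
\<close>

section \<open>Chains driven by involutions and their Rayleigh quotient\<close>

locale finite_involutions =
  fixes S :: "'s set" and I :: "'i set" and t :: "'i \<Rightarrow> 's \<Rightarrow> 's"
  assumes finite_S: "finite S" and finite_I: "finite I"
    and closed: "x \<in> I \<Longrightarrow> s \<in> S \<Longrightarrow> t x s \<in> S"
    and invol: "x \<in> I \<Longrightarrow> s \<in> S \<Longrightarrow> t x (t x s) = s"
begin

definition lap :: "('s \<Rightarrow> real) \<Rightarrow> 's \<Rightarrow> real" where
  "lap f s = (\<Sum>x\<in>I. (f s - f (t x s)) / 2)"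

definition ip :: "('s \<Rightarrow> real) \<Rightarrow> ('s \<Rightarrow> real) \<Rightarrow> real" where
  "ip f g = (\<Sum>s\<in>S. f s * g s)"

lemma sum_involution:
  assumes "x \<in> I"
  shows "(\<Sum>s\<in>S. h (t x s)) = (\<Sum>s\<in>S. h s)"
  by (rule sum.reindex_bij_witness[of _ "t x" "t x"]) (use assms closed invol in auto)

text \<open>
  The Dirichlet form. Reindexing the sum along the involution exchanges \<open>s\<close> and \<open>t x s\<close>, and averaging
  the two expressions makes it symmetric in \<open>f\<close> and \<open>g\<close> and nonnegative on the diagonal.
\<close>

lemma ip_lap:
  "ip g (lap f) = (\<Sum>x\<in>I. \<Sum>s\<in>S. (g s - g (t x s)) * (f s - f (t x s))) / 4"
proof -
  have *: "(\<Sum>s\<in>S. g s * ((f s - f (t x s)) / 2))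
      = (\<Sum>s\<in>S. (g s - g (t x s)) * (f s - f (t x s))) / 4" if x: "x \<in> I" for x
  proof -
    have "(\<Sum>s\<in>S. g s * (f s - f (t x s)))
        = (\<Sum>s\<in>S. g (t x s) * (f (t x s) - f (t x (t x s))))"
      using sum_involution[OF x, of "\<lambda>s. g s * (f s - f (t x s))"] by simp
    also have "\<dots> = (\<Sum>s\<in>S. g (t x s) * (f (t x s) - f s))"
      by (rule sum.cong) (simp_all add: invol x)
    finally have "2 * (\<Sum>s\<in>S. g s * (f s - f (t x s)))
        = (\<Sum>s\<in>S. g s * (f s - f (t x s)) + g (t x s) * (f (t x s) - f s))"
      by (simp add: sum.distrib)
    also have "\<dots> = (\<Sum>s\<in>S. (g s - g (t x s)) * (f s - f (t x s)))"
      by (rule sum.cong) (simp_all add: algebra_simps)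
    finally show ?thesis by (simp add: sum_divide_distrib[symmetric])
  qed
  have "ip g (lap f) = (\<Sum>x\<in>I. \<Sum>s\<in>S. g s * ((f s - f (t x s)) / 2))"
    unfolding ip_def lap_def sum_distrib_left by (rule sum.swap)
  also have "\<dots> = (\<Sum>x\<in>I. (\<Sum>s\<in>S. (g s - g (t x s)) * (f s - f (t x s))) / 4)"
    by (rule sum.cong[OF refl *])
  finally show ?thesis by (simp add: sum_divide_distrib)
qed

lemma ip_lap_commute: "ip g (lap f) = ip f (lap g)"
  unfolding ip_lap by (simp add: mult.commute)

lemma ip_commute: "ip g f = ip f g"
  unfolding ip_def by (simp add: mult.commute)

lemma ip_lap_nonneg: "0 \<le> ip f (lap f)"
  unfolding ip_lap by (auto intro!: sum_nonneg)

lemma invariant_if_ip_lap_zero: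
  assumes "ip f (lap f) = 0" "x \<in> I" "s \<in> S"
  shows "f (t x s) = f s"
proof -
  have "(\<Sum>x\<in>I. \<Sum>s\<in>S. (f s - f (t x s)) * (f s - f (t x s))) = 0"
    using assms(1) unfolding ip_lap by simp
  then have "(\<Sum>s\<in>S. (f s - f (t x s)) * (f s - f (t x s))) = 0"
    by (subst (asm) sum_nonneg_eq_0_iff) (use assms(2) finite_I in \<open>auto intro!: sum_nonneg\<close>)
  then show ?thesis
    by (subst (asm) sum_nonneg_eq_0_iff) (use assms(3) finite_S in auto)
qed

lemma lap_lincomb: "lap (\<lambda>s. a * f s + b * g s) s = a * lap f s + b * lap g s"
  unfolding lap_def sum_distrib_left sum.distrib[symmetric]
  by (rule sum.cong) (simp_all add: algebra_simps diff_divide_distrib add_divide_distrib)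

lemma ip_lincomb: "ip h (\<lambda>s. a * f s + b * g s) = a * ip h f + b * ip h g"
  unfolding ip_def sum_distrib_left sum.distrib[symmetric]
  by (rule sum.cong) (simp_all add: algebra_simps)

lemma ip_cong: "(\<And>s. s \<in> S \<Longrightarrow> f s = f' s) \<Longrightarrow> (\<And>s. s \<in> S \<Longrightarrow> g s = g' s) \<Longrightarrow> ip f g = ip f' g'"
  unfolding ip_def by (rule sum.cong) auto

lemma ip_self_pos:
  assumes "\<exists>s\<in>S. f s \<noteq> 0"
  shows "0 < ip f f"
proof -
  obtain s where "s \<in> S" "f s \<noteq> 0" using assms by blast
  then show ?thesis unfolding ip_def
    by (intro sum_pos2[OF finite_S]) (auto simp: zero_less_mult_iff)
qed

text \<open>
  The unit sphere of the mean-zero functions supported on \<open>S\<close> is compact in the topology of pointwise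
  convergence, so the Dirichlet form attains its minimum there; homogeneity extends the bound to all
  mean-zero functions.
\<close>

lemma rayleigh_minimiser:
  assumes phi: "sum \<phi> S = 0" "\<exists>s\<in>S. \<phi> s \<noteq> 0" "ip \<phi> (lap \<phi>) \<le> \<mu> * ip \<phi> \<phi>"
  obtains f where "sum f S = 0" "ip f f = 1" "ip f (lap f) \<le> \<mu>"
    "\<And>g. sum g S = 0 \<Longrightarrow> ip f (lap f) * ip g g \<le> ip g (lap g)"
proof -
  define C where "C = {f. (\<forall>s. s \<notin> S \<longrightarrow> f s = 0) \<and> sum f S = 0 \<and> ip f f = 1}"
  have normalise: "\<exists>h\<in>C. ip h (lap h) = ip g (lap g) / ip g g"
    if g: "sum g S = 0" "\<exists>s\<in>S. g s \<noteq> 0" for g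
  proof
    define c where "c = 1 / sqrt (ip g g)"
    define h where "h = (\<lambda>s. if s \<in> S then c * g s + 0 * g s else 0)"
    have pos: "ip g g > 0" using ip_self_pos g(2) .
    have c2: "c * c = 1 / ip g g" using pos unfolding c_def by simp
    have hg: "ip h k = c * ip g k" for k
    proof -
      have "ip h k = ip k (\<lambda>s. c * g s + 0 * g s)"
        by (subst ip_commute) (rule ip_cong, simp_all add: h_def)
      then show ?thesis by (simp only: ip_lincomb) (simp add: ip_commute)
    qed
    have lh: "ip k (lap h) = c * ip k (lap g)" for k
      by (simp only: ip_lap_commute[of k h] hg) (simp only: ip_lap_commute)
    have "ip h h = c * c * ip g g" by (simp add: hg ip_commute[of g h])
    then have "ip h h = 1" using c2 pos by simp
    moreover have "sum h S = c * sum g S"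
      unfolding sum_distrib_left by (rule sum.cong) (simp_all add: h_def)
    ultimately show "h \<in> C" unfolding C_def using g(1) by (auto simp: h_def)
    show "ip h (lap h) = ip g (lap g) / ip g g"
      using c2 by (simp add: hg lh mult.assoc[symmetric])
  qed
  have "compact C"
  proof -
    let ?B = "\<lambda>s. if s \<in> S then {-1..1::real} else {0}"
    have "compactin (product_topology (\<lambda>_. euclidean) UNIV) (PiE UNIV ?B)"
      by (simp add: compactin_PiE)
    then have B: "compact (PiE UNIV ?B)" by (simp add: euclidean_product_topology)
    have "C = PiE UNIV ?B \<inter> {f. sum f S = 0 \<and> ip f f = 1}"
    proof -
      have "f s \<in> {-1..1}" if "ip f f = 1" "s \<in> S" for f s
      proof -
        have "f s * f s \<le> ip f f" unfolding ip_def
          by (rule member_le_sum) (use that finite_S in auto)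
        then show ?thesis using that(1)
          by (auto simp: power2_eq_square[symmetric] abs_square_le_1 abs_le_iff)
      qed
      then show ?thesis unfolding C_def by (auto simp: PiE_iff split: if_splits)
    qed
    moreover have "closed {f. sum f S = 0 \<and> ip f f = 1}"
      unfolding ip_def
      by (intro closed_Collect_conj closed_Collect_eq continuous_intros continuous_on_product_coordinates)
    ultimately show ?thesis using B by (simp add: compact_Int_closed)
  qed
  moreover have "C \<noteq> {}" using normalise[OF phi(1,2)] by auto
  moreover have "continuous_on C (\<lambda>f. ip f (lap f))"
    unfolding ip_def lap_def
    by (intro continuous_intros continuous_on_subset[OF continuous_on_product_coordinates]) auto
  ultimately obtain f where f: "f \<in> C" "\<And>h. h \<in> C \<Longrightarrow> ip f (lap f) \<le> ip h (lap h)"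
    using continuous_attains_inf[of C "\<lambda>f. ip f (lap f)"] by blast
  have min: "ip f (lap f) * ip g g \<le> ip g (lap g)" if "sum g S = 0" for g
  proof (cases "\<exists>s\<in>S. g s \<noteq> 0")
    case True
    then have "ip f (lap f) \<le> ip g (lap g) / ip g g"
      using normalise[OF that True] f(2) by force
    then show ?thesis using ip_self_pos[OF True] by (simp add: pos_le_divide_eq)
  next
    case False
    then have "ip g g = 0" unfolding ip_def by auto
    then show ?thesis using ip_lap_nonneg by simp
  qed
  have "ip f (lap f) * ip \<phi> \<phi> \<le> \<mu> * ip \<phi> \<phi>"
    using min[OF phi(1)] phi(3) by linarith
  then have "ip f (lap f) \<le> \<mu>" using ip_self_pos[OF phi(2)] by simp
  then show thesis using that f(1) min by (auto simp: C_def)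
qed

text \<open>
  A minimiser \<open>f\<close> of the Rayleigh quotient is an eigenfunction: the residual \<open>r = lap f - \<nu> f\<close> again
  has mean zero, and perturbing \<open>f\<close> in its direction would decrease the quotient unless \<open>r = 0\<close>. If
  the eigenvalue were 0 then \<open>f\<close> would be invariant under all moves, hence constant by
  irreducibility, hence 0.
\<close>

lemma eigenvalue_below_rayleigh_quotient:
  assumes conn: "\<And>f :: 's \<Rightarrow> real. (\<And>x s. x \<in> I \<Longrightarrow> s \<in> S \<Longrightarrow> f (t x s) = f s)
      \<Longrightarrow> (\<And>s s'. s \<in> S \<Longrightarrow> s' \<in> S \<Longrightarrow> f s = f s')"
    and phi: "sum \<phi> S = 0" "\<exists>s\<in>S. \<phi> s \<noteq> 0" "ip \<phi> (lap \<phi>) \<le> \<mu> * ip \<phi> \<phi>"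
  shows "\<exists>\<nu>. 0 < \<nu> \<and> \<nu> \<le> \<mu> \<and> eigenvalue_on S lap \<nu>"
proof -
  obtain f where f: "sum f S = 0" "ip f f = 1" "ip f (lap f) \<le> \<mu>"
    and min: "\<And>g. sum g S = 0 \<Longrightarrow> ip f (lap f) * ip g g \<le> ip g (lap g)"
    using rayleigh_minimiser[OF phi] by blast
  define \<nu> where "\<nu> = ip f (lap f)"
  define r where "r = (\<lambda>s. 1 * lap f s + (- \<nu>) * f s)"
  have sum_ip: "sum h S = ip (\<lambda>_. 1) h" for h unfolding ip_def by simp
  have "ip (\<lambda>_. 1) (lap f) = 0" unfolding ip_lap by simp
  then have r0: "sum r S = 0"
    using f(1) unfolding r_def sum_ip by (simp only: ip_lincomb)
  define q where "q = ip r (lap r) - \<nu> * ip r r"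
  have ip_r: "ip h r = ip h (lap f) - \<nu> * ip h f" for h
    unfolding r_def by (subst ip_lincomb) simp
  note rr = ip_r[of r]
  \<comment> \<open>Minimality of f, tested against f + e r, as a quadratic inequality in e.\<close>
  have quad: "0 \<le> 2 * e * ip r r + e\<^sup>2 * q" for e
  proof -
    define g where "g = (\<lambda>s. 1 * f s + e * r s)"
    have gi: "ip h g = ip h f + e * ip h r" for h
      unfolding g_def by (subst ip_lincomb) simp
    have "lap g = (\<lambda>s. 1 * lap f s + e * lap r s)"
      unfolding g_def lap_lincomb ..
    then have gl: "ip h (lap g) = ip h (lap f) + e * ip h (lap r)" for h
      using ip_lincomb[of h 1 "lap f" e "lap r"] by simp
    have "sum g S = 0"
      unfolding sum_ip gi using f(1) r0 by (simp add: sum_ip)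
    from min[OF this] have "0 \<le> ip g (lap g) - \<nu> * ip g g" by (simp add: \<nu>_def)
    also have "ip g g = 1 + 2 * e * ip r f + e\<^sup>2 * ip r r"
    proof -
      have "ip g f = 1 + e * ip r f" "ip g r = ip r f + e * ip r r"
        using gi[of f] gi[of r] f(2) ip_commute[of g f] ip_commute[of g r] ip_commute[of f r]
        by simp_all
      then show ?thesis by (simp add: gi[of g] algebra_simps power2_eq_square)
    qed
    also have "ip g (lap g) = \<nu> + 2 * e * ip r (lap f) + e\<^sup>2 * ip r (lap r)"
    proof -
      have "ip g (lap f) = \<nu> + e * ip r (lap f)"
        using gl[of f] ip_lap_commute[of g f] ip_lap_commute[of f r] by (simp add: \<nu>_def)
      moreover have "ip g (lap r) = ip r (lap f) + e * ip r (lap r)"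
        using gl[of r] ip_lap_commute[of g r] by simp
      ultimately show ?thesis by (simp add: gl[of g] algebra_simps power2_eq_square)
    qed
    finally show ?thesis unfolding q_def rr by (simp add: algebra_simps)
  qed
  have r_null: "ip r r \<le> 0"
  proof (rule ccontr)
    assume "\<not> ip r r \<le> 0"
    then have pos: "ip r r > 0" by simp
    define d where "d = \<bar>q\<bar> + 1"
    \<comment> \<open>The step -a makes the quadratic negative: its linear term outweighs the term in q.\<close>
    define a where "a = ip r r / d"
    have d: "d > 0" "q \<le> d" unfolding d_def by auto
    then have a: "a > 0" "a * d = ip r r" using pos unfolding a_def by auto
    have "0 \<le> 2 * (- a) * ip r r + (- a)\<^sup>2 * q" by (rule quad)
    also have "\<dots> \<le> 2 * (- a) * ip r r + (- a)\<^sup>2 * d"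
      using d by (intro add_left_mono mult_left_mono) auto
    also have "(- a)\<^sup>2 * d = a * ip r r"
      by (simp add: power2_eq_square mult.assoc a(2))
    also have "2 * (- a) * ip r r + a * ip r r = - (a * ip r r)" by simp
    also have "\<dots> < 0" using a(1) pos by simp
    finally show False by simp
  qed
  have "r s = 0" if "s \<in> S" for s
  proof (rule ccontr)
    assume "r s \<noteq> 0"
    with that have "\<exists>s\<in>S. r s \<noteq> 0" by blast
    from ip_self_pos[OF this] show False using r_null by simp
  qed
  then have eig: "lap f s = \<nu> * f s" if "s \<in> S" for s
    using that unfolding r_def by simp
  have nz: "\<exists>s\<in>S. f s \<noteq> 0"
  proof (rule ccontr)
    assume "\<not> ?thesis"
    then have "ip f f = 0" unfolding ip_def by simp
    then show False using f(2) by simp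
  qed
  have "\<nu> \<noteq> 0"
  proof
    assume "\<nu> = 0"
    then have inv: "f (t x s) = f s" if "x \<in> I" "s \<in> S" for x s
      using invariant_if_ip_lap_zero that unfolding \<nu>_def by blast
    obtain s0 where s0: "s0 \<in> S" "f s0 \<noteq> 0" using nz by blast
    have "sum f S = (\<Sum>s\<in>S. f s0)"
      by (intro sum.cong refl conn[OF _ _ s0(1)] inv)
    then show False using f(1) s0 finite_S by auto
  qed
  moreover have "0 \<le> \<nu>" unfolding \<nu>_def by (rule ip_lap_nonneg)
  moreover have "eigenvalue_on S lap \<nu>" unfolding eigenvalue_on_def using eig nz by blast
  moreover have "\<nu> \<le> \<mu>" using f(3) by (simp only: \<nu>_def)
  ultimately show ?thesis by (intro exI[of _ \<nu>]) simp
qed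

end

abbreviation "laplacian \<equiv> finite_involutions.lap"

text \<open>
  If \<open>\<pi>\<close> carries each move of the large chain either to a move of the small chain or to no move, and
  each small move arises from exactly one large move, then the image of the large chain under \<open>\<pi>\<close> is
  the small chain, and composition with \<open>\<pi>\<close> turns eigenfunctions into eigenfunctions.
\<close>

lemma eigenvalue_pullback:
  assumes fi: "finite_involutions S I t" and fi': "finite_involutions S' I' t'"
    and surj: "\<pi> ` S = S'"
    and h: "inj_on h I'" "h ` I' \<subseteq> I"
    and match: "\<And>y s. y \<in> I' \<Longrightarrow> s \<in> S \<Longrightarrow> \<pi> (t (h y) s) = t' y (\<pi> s)"
    and idle: "\<And>x s. x \<in> I \<Longrightarrow> x \<notin> h ` I' \<Longrightarrow> s \<in> S \<Longrightarrow> \<pi> (t x s) = \<pi> s"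
    and ev: "eigenvalue_on S' (laplacian I' t') \<mu>"
  shows "eigenvalue_on S (laplacian I t) \<mu>"
proof -
  obtain f where f: "\<exists>s\<in>S'. f s \<noteq> 0" "\<And>s. s \<in> S' \<Longrightarrow> laplacian I' t' f s = \<mu> * f s"
    using ev unfolding eigenvalue_on_def by blast
  have "laplacian I t (\<lambda>s. f (\<pi> s)) s = \<mu> * f (\<pi> s)" if s: "s \<in> S" for s
  proof -
    have "laplacian I t (\<lambda>s. f (\<pi> s)) s = (\<Sum>x\<in>I. (f (\<pi> s) - f (\<pi> (t x s))) / 2)"
      by (simp add: finite_involutions.lap_def[OF fi])
    also have "\<dots> = (\<Sum>x\<in>h ` I'. (f (\<pi> s) - f (\<pi> (t x s))) / 2)"
      by (rule sum.mono_neutral_right)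
         (use h idle s finite_involutions.finite_I[OF fi] in auto)
    also have "\<dots> = (\<Sum>y\<in>I'. (f (\<pi> s) - f (t' y (\<pi> s))) / 2)"
      by (subst sum.reindex[OF h(1)]) (auto simp: match s intro!: sum.cong)
    also have "\<dots> = laplacian I' t' f (\<pi> s)"
      by (simp add: finite_involutions.lap_def[OF fi'])
    finally show ?thesis using f(2) surj s by auto
  qed
  moreover have "\<exists>s\<in>S. f (\<pi> s) \<noteq> 0" using f(1) surj by auto
  ultimately show ?thesis unfolding eigenvalue_on_def
    by (intro exI[of _ "\<lambda>s. f (\<pi> s)"]) auto
qed

text \<open>
  Commuting involutions have a common eigenfunction in each nonzero space of functions \<open>V\<close> that they
  preserve. One involution at a time: of \<open>g + g \<circ> F j\<close> and \<open>g - g \<circ> F j\<close> at least one is nonzero,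
  because they add up to \<open>2 g\<close>.
\<close>

lemma simultaneous_sign_eigenfunction:
  fixes V :: "('s \<Rightarrow> real) \<Rightarrow> bool"
  assumes "finite J"
    and F: "\<And>j s. j \<in> J \<Longrightarrow> s \<in> S \<Longrightarrow> F j s \<in> S"
      "\<And>j s. j \<in> J \<Longrightarrow> s \<in> S \<Longrightarrow> F j (F j s) = s"
      "\<And>j l s. j \<in> J \<Longrightarrow> l \<in> J \<Longrightarrow> s \<in> S \<Longrightarrow> F j (F l s) = F l (F j s)"
    and V: "\<And>f e j. V f \<Longrightarrow> j \<in> J \<Longrightarrow> V (\<lambda>s. 1 * f s + e * f (F j s))"
    and f: "V f" "\<exists>s\<in>S. f s \<noteq> 0"
  shows "\<exists>g \<epsilon>. V g \<and> (\<exists>s\<in>S. g s \<noteq> 0) \<and>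
    (\<forall>j\<in>J. (\<epsilon> j = 1 \<or> \<epsilon> j = - 1) \<and> (\<forall>s\<in>S. g (F j s) = \<epsilon> j * g s))"
proof -
  have "J' \<subseteq> J \<Longrightarrow> \<exists>g \<epsilon>. V g \<and> (\<exists>s\<in>S. g s \<noteq> 0) \<and>
    (\<forall>j\<in>J'. (\<epsilon> j = 1 \<or> \<epsilon> j = - 1) \<and> (\<forall>s\<in>S. g (F j s) = \<epsilon> j * g s))" if "finite J'" for J'
    using that
  proof (induction J')
    case empty
    then show ?case using f by auto
  next
    case (insert j J')
    then obtain g \<epsilon> where g: "V g" "\<exists>s\<in>S. g s \<noteq> 0"
      and g\<epsilon>: "\<forall>l\<in>J'. (\<epsilon> l = 1 \<or> \<epsilon> l = - 1) \<and> (\<forall>s\<in>S. g (F l s) = \<epsilon> l * g s)"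
      using insert.IH[OF subset_trans[OF subset_insertI insert.prems]]
      by (elim exE conjE) (rule that; assumption)
    have \<epsilon>: "\<And>l. l \<in> J' \<Longrightarrow> \<epsilon> l = 1 \<or> \<epsilon> l = - 1"
        "\<And>l s. l \<in> J' \<Longrightarrow> s \<in> S \<Longrightarrow> g (F l s) = \<epsilon> l * g s"
      using g\<epsilon> by blast+
    have j: "j \<in> J" and J': "\<And>l. l \<in> J' \<Longrightarrow> l \<in> J" using insert.prems by auto
    define k where "k e s = 1 * g s + e * g (F j s)" for e :: real and s
    obtain s where s: "s \<in> S" "g s \<noteq> 0" using g(2) by blast
    have "k 1 s + k (- 1) s = 2 * g s" by (simp add: k_def)
    then obtain e where e: "e = 1 \<or> e = - 1" "k e s \<noteq> 0"
      using s(2) by (metis add_0 mult_eq_0_iff zero_neq_numeral)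
    have "V (k e)" unfolding k_def by (rule V[OF g(1) j])
    moreover have "k e (F j s) = e * k e s" if "s \<in> S" for s
      using e(1) by (auto simp: k_def F(2)[OF j that])
    moreover have "k e (F l s) = \<epsilon> l * k e s" if "l \<in> J'" "s \<in> S" for l s
      using that by (simp add: k_def F(3)[OF j J'[OF that(1)] that(2)] \<epsilon>(2) F(1)[OF j] algebra_simps)
    ultimately show ?case
      using e s \<epsilon>(1) insert.hyps
      by (intro exI[of _ "k e"] exI[of _ "\<epsilon>(j := e)"]) auto
  qed
  then show ?thesis using assms(1) by blast
qed

section \<open>The East process as a chain of involutions\<close>

lemma expectation_fair_bit:
  "measure_pmf.expectation (map_pmf h fair_bit) (f :: _ \<Rightarrow> real) = (f (h 0) + f (h 1)) / 2"
  by (simp add: fair_bit_def map_pmf_comp)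

definition east_flip :: "nat \<Rightarrow> (nat \<Rightarrow> bit) \<Rightarrow> (nat \<Rightarrow> bit)" where
  "east_flip y \<sigma> = (if y = 1 \<or> (y \<ge> 2 \<and> \<sigma> (y - 1) = 0) then \<sigma>(y := \<sigma> y + 1) else \<sigma>)"

lemma east_configs_iff: "\<sigma> \<in> east_configs m \<longleftrightarrow> (\<forall>y. y \<notin> {1..m} \<longrightarrow> \<sigma> y = undefined)"
  unfolding east_configs_def by (auto simp: PiE_iff extensional_def)

interpretation east: finite_involutions "east_configs m" "{1..m}" east_flip for m
proof
  show "finite (east_configs m)" unfolding east_configs_def by (intro finite_PiE) auto
  show "finite {1..m}" by simp
  show "east_flip x s \<in> east_configs m" if "x \<in> {1..m}" "s \<in> east_configs m" for x s
    using that by (auto simp: east_configs_iff east_flip_def)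
  show "east_flip x (east_flip x s) = s" for x s
    by (auto simp: east_flip_def add.assoc)
qed

lemma minus_east_generator: "- east_generator m f \<sigma> = laplacian {1..m} east_flip f \<sigma>"
proof -
  have "measure_pmf.expectation (east_update x \<sigma>) f - f \<sigma> = - ((f \<sigma> - f (east_flip x \<sigma>)) / 2)" for x
  proof (cases "x = 1 \<or> (x \<ge> 2 \<and> \<sigma> (x - 1) = 0)")
    case True
    have "f (\<sigma>(x := 0)) + f (\<sigma>(x := 1)) = f \<sigma> + f (\<sigma>(x := \<sigma> x + 1))"
      by (cases "\<sigma> x") (auto simp: fun_upd_idem)
    moreover have "east_update x \<sigma> = map_pmf (\<lambda>b. \<sigma>(x := b)) fair_bit"
      "east_flip x \<sigma> = \<sigma>(x := \<sigma> x + 1)"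
      using True by (simp_all only: east_update_def east_flip_def if_True)
    moreover have "a + b = c + d \<Longrightarrow> (a + b) / 2 - c = - ((c - d) / 2)" for a b c d :: real
      by (simp add: field_simps)
    ultimately show ?thesis by (simp only: expectation_fair_bit)
  next
    case False
    then have "east_update x \<sigma> = return_pmf \<sigma>" "east_flip x \<sigma> = \<sigma>"
      by (simp_all only: east_update_def east_flip_def if_False)
    then show ?thesis by simp
  qed
  then show ?thesis
    unfolding east_generator_def clock_generator_def east.lap_def by (simp add: sum_negf)
qed

text \<open>
  Induction on the number \<open>k\<close> of spins in which two configurations may differ: to change spin
  \<open>k + 1\<close>, first set the spins before it to 0, which facilitates it.
\<close>

lemma east_irreducible:
  fixes f :: "(nat \<Rightarrow> bit) \<Rightarrow> real"
  assumes inv: "\<And>y \<sigma>. y \<in> {1..m} \<Longrightarrow> \<sigma> \<in> east_configs m \<Longrightarrow> f (east_flip y \<sigma>) = f \<sigma>"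
    and "\<sigma> \<in> east_configs m" "\<tau> \<in> east_configs m"
  shows "f \<sigma> = f \<tau>"
proof -
  have "f \<sigma> = f \<tau>" if "k \<le> m" "\<sigma> \<in> east_configs m" "\<tau> \<in> east_configs m"
    "\<And>y. y > k \<Longrightarrow> \<sigma> y = \<tau> y" for k \<sigma> \<tau>
    using that
  proof (induction k arbitrary: \<sigma> \<tau>)
    case 0
    then have "\<sigma> = \<tau>" by (intro ext) (metis atLeastAtMost_iff east_configs_iff gr0I not_one_le_zero)
    then show ?case by simp
  next
    case (Suc k)
    show ?case
    proof (cases "\<sigma> (Suc k) = \<tau> (Suc k)")
      case True
      show ?thesis
      proof (rule Suc.IH)
        show "\<sigma> y = \<tau> y" if "k < y" for y
          using that True Suc.prems(4)[of y] by (cases "y = Suc k") auto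
      qed (use Suc.prems(1-3) in simp_all)
    next
      case False
      define \<sigma>0 where "\<sigma>0 = (\<lambda>y. if y \<in> {1..k} then 0 else \<sigma> y)"
      have c: "\<sigma>0 \<in> east_configs m"
        using Suc.prems by (auto simp: east_configs_iff \<sigma>0_def)
      have k: "Suc k \<in> {1..m}" using Suc.prems(1) by simp
      have flip: "east_flip (Suc k) \<sigma>0 = \<sigma>0(Suc k := \<tau> (Suc k))"
        using False by (cases "\<sigma> (Suc k)"; cases "\<tau> (Suc k)") (auto simp: east_flip_def \<sigma>0_def)
      have "f \<sigma> = f \<sigma>0"
        by (rule Suc.IH) (use Suc.prems(1,2) c in \<open>simp_all add: \<sigma>0_def\<close>)
      also have "\<dots> = f (east_flip (Suc k) \<sigma>0)" using inv[OF k c] by simp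
      also have "\<dots> = f \<tau>"
      proof (rule Suc.IH)
        show "east_flip (Suc k) \<sigma>0 y = \<tau> y" if "k < y" for y
          unfolding flip using that Suc.prems(4)[of y] by (auto simp: \<sigma>0_def)
      qed (use Suc.prems(1,3) east.closed[OF k c] in simp_all)
      finally show ?thesis .
    qed
  qed
  from this[OF order_refl assms(2,3)] show ?thesis
    using assms(2,3) by (simp add: east_configs_iff)
qed

text \<open>
  Spins are influenced only by spins to their left, so the first \<open>p\<close> spins form an East process.
\<close>

lemma east_eigenvalue_mono:
  assumes "p \<le> m" "eigenvalue_on (east_configs p) (laplacian {1..p} east_flip) \<mu>"
  shows "eigenvalue_on (east_configs m) (laplacian {1..m} east_flip) \<mu>"
proof (rule eigenvalue_pullback[where h = id and \<pi> = "\<lambda>\<sigma>. restrict \<sigma> {1..p}", OF _ _ _ _ _ _ _ assms(2)])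
  show "(\<lambda>\<sigma>. restrict \<sigma> {1..p}) ` east_configs m = east_configs p"
  proof (intro equalityI subsetI)
    fix \<sigma> assume "\<sigma> \<in> east_configs p"
    then have "\<sigma> = restrict \<sigma> {1..p}" "\<sigma> \<in> east_configs m"
      using assms(1) by (auto simp: east_configs_iff restrict_def)
    then show "\<sigma> \<in> (\<lambda>\<sigma>. restrict \<sigma> {1..p}) ` east_configs m" by (rule image_eqI)
  qed (auto simp: east_configs_iff)
  show "restrict (east_flip (id y) \<sigma>) {1..p} = east_flip y (restrict \<sigma> {1..p})"
    if "y \<in> {1..p}" for y \<sigma>
  proof -
    have "y - 1 \<in> {1..p}" if "y \<ge> 2" using that \<open>y \<in> {1..p}\<close> by auto
    then show ?thesis using that by (auto simp: east_flip_def fun_eq_iff)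
  qed
  show "restrict (east_flip x \<sigma>) {1..p} = restrict \<sigma> {1..p}" if "x \<notin> id ` {1..p}" for x \<sigma>
    using that by (auto simp: east_flip_def fun_eq_iff)
qed (use assms(1) in \<open>simp_all add: east.finite_involutions_axioms del: One_nat_def\<close>)

section \<open>The matrix walk and the characters of its rows\<close>

text \<open>
  From here on rows and columns are numbered from 0, except that \<open>row_add x\<close> adds row \<open>x\<close> to row
  \<open>x - 1\<close>, so that \<open>x\<close> ranges over the clocks of the generator.
\<close>

locale column_walk =
  fixes n :: nat and cs :: "nat list"
  assumes cs_nonempty: "cs \<noteq> []" and cs_sorted: "sorted_wrt (<) cs" and cs_range: "set cs \<subseteq> {1..n}"
begin

abbreviation (input) "k \<equiv> length cs"
abbreviation (input) "S \<equiv> column_matrices n cs"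

text \<open>
  The row of the lowest nonzero entry of a column, which is a fixed 1.
\<close>

definition lead :: "nat \<Rightarrow> nat" where "lead j = cs ! j - 1"

lemma cs_nth: "j < k \<Longrightarrow> cs ! j = Suc (lead j)"
  using subsetD[OF cs_range nth_mem[of j cs]] by (simp add: lead_def)

lemma lead_less_n: "j < k \<Longrightarrow> lead j < n"
  using subsetD[OF cs_range nth_mem[of j cs]] cs_nth[of j] by simp

lemma lead_strict_mono: "j < l \<Longrightarrow> l < k \<Longrightarrow> lead j < lead l"
  using sorted_wrt_nth_less[OF cs_sorted, of j l] cs_nth[of j] cs_nth[of l] by simp

lemma lead_mono: "j \<le> l \<Longrightarrow> l < k \<Longrightarrow> lead j \<le> lead l"
  using lead_strict_mono[of j l] by (cases "j = l") auto

lemma state_iff: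
  "A \<in> S \<longleftrightarrow> A \<in> carrier_mat n k \<and>
     (\<forall>j<k. (\<forall>z<n. lead j < z \<longrightarrow> A $$ (z, j) = 0) \<and> A $$ (lead j, j) = 1)"
proof -
  have "(\<forall>j\<in>{1..k}. (\<forall>x\<in>{1..n}. x > cs ! (j - 1) \<longrightarrow> A $$ (x - 1, j - 1) = 0) \<and>
          A $$ (cs ! (j - 1) - 1, j - 1) = 1) \<longleftrightarrow>
     (\<forall>j<k. (\<forall>z<n. lead j < z \<longrightarrow> A $$ (z, j) = 0) \<and> A $$ (lead j, j) = 1)"
  proof -
    have shift: "(\<forall>j\<in>{1..q}. P (j - 1)) \<longleftrightarrow> (\<forall>j<q. P j)" for q :: nat and P
    proof (intro iffI allI impI ballI)
      show "P j" if "\<forall>j\<in>{1..q}. P (j - 1)" "j < q" for j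
        using bspec[OF that(1), of "Suc j"] that(2) by simp
      show "P (j - 1)" if "\<forall>j<q. P j" "j \<in> {1..q}" for j
        using that by auto
    qed
    have "(\<forall>x\<in>{1..n}. x > cs ! j \<longrightarrow> A $$ (x - 1, j) = 0) \<longleftrightarrow>
        (\<forall>z<n. lead j < z \<longrightarrow> A $$ (z, j) = 0)" if "j < k" for j
    proof -
      have "(\<forall>x\<in>{1..n}. x > cs ! j \<longrightarrow> A $$ (x - 1, j) = 0) \<longleftrightarrow>
        (\<forall>x\<in>{1..n}. lead j < x - 1 \<longrightarrow> A $$ (x - 1, j) = 0)"
        using cs_nth[OF that] by (intro ball_cong refl) auto
      also have "\<dots> \<longleftrightarrow> (\<forall>z<n. lead j < z \<longrightarrow> A $$ (z, j) = 0)" by (rule shift)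
      finally show ?thesis .
    qed
    then show ?thesis
      by (subst shift[of k "\<lambda>j. (\<forall>x\<in>{1..n}. x > cs ! j \<longrightarrow> A $$ (x - 1, j) = 0) \<and>
          A $$ (cs ! j - 1, j) = 1"]) (simp add: lead_def)
  qed
  then show ?thesis by (simp only: column_matrices_def mem_Collect_eq)
qed

lemma state_dim: "A \<in> S \<Longrightarrow> dim_row A = n" "A \<in> S \<Longrightarrow> dim_col A = k"
  unfolding state_iff by auto

lemma state_zero: "A \<in> S \<Longrightarrow> j < k \<Longrightarrow> z < n \<Longrightarrow> lead j < z \<Longrightarrow> A $$ (z, j) = 0"
  unfolding state_iff by auto

lemma state_one: "A \<in> S \<Longrightarrow> j < k \<Longrightarrow> A $$ (lead j, j) = 1"
  unfolding state_iff by auto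

text \<open>
  The entries from the lead downwards are prescribed.
\<close>

lemma state_eqI:
  assumes "A \<in> S" "A' \<in> S" "\<And>z j. z < n \<Longrightarrow> j < k \<Longrightarrow> z < lead j \<Longrightarrow> A $$ (z, j) = A' $$ (z, j)"
  shows "A = A'"
proof (rule eq_matI)
  fix z j assume zj: "z < dim_row A'" "j < dim_col A'"
  then show "A $$ (z, j) = A' $$ (z, j)"
    using assms state_zero state_one state_dim by (cases z "lead j" rule: linorder_cases) auto
qed (use assms state_dim in auto)

lemma finite_states: "finite S"
proof (rule finite_subset)
  show "S \<subseteq> (\<lambda>f. mat n k f) ` (({..<n} \<times> {..<k}) \<rightarrow>\<^sub>E UNIV)"
  proof
    fix A assume A: "A \<in> S"
    show "A \<in> (\<lambda>f. mat n k f) ` (({..<n} \<times> {..<k}) \<rightarrow>\<^sub>E UNIV)"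
    proof (rule image_eqI)
      show "A = mat n k (restrict (\<lambda>p. A $$ p) ({..<n} \<times> {..<k}))"
        by (rule eq_matI) (simp_all add: state_dim[OF A])
    qed simp
  qed
  have "(UNIV :: bit set) \<subseteq> {0, 1}"
  proof
    show "x \<in> {0, 1}" for x :: bit by (cases x) simp_all
  qed
  then have "finite (UNIV :: bit set)" by (rule finite_subset) simp
  then show "finite ((\<lambda>f. mat n k f) ` (({..<n} \<times> {..<k}) \<rightarrow>\<^sub>E (UNIV :: bit set)))"
    by (intro finite_imageI finite_PiE) simp_all
qed

lemma states_nonempty: "S \<noteq> {}"
proof -
  have "mat n k (\<lambda>(z, j). of_bool (z = lead j)) \<in> S"
    unfolding state_iff by (auto simp: lead_less_n)
  then show ?thesis by blast
qed

definition row_add :: "nat \<Rightarrow> bit mat \<Rightarrow> bit mat" where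
  "row_add x A = addrow 1 (x - 1) x A"

lemma row_add_entry:
  assumes "A \<in> S" "z < n" "j < k"
  shows "row_add x A $$ (z, j) = A $$ (z, j) + (if z = x - 1 then A $$ (x, j) else 0)"
  using assms by (auto simp: row_add_def state_dim add.commute)

lemma row_add_closed:
  assumes x: "x \<in> {1..<n}" and A: "A \<in> S"
  shows "row_add x A \<in> S"
proof -
  have carrier: "row_add x A \<in> carrier_mat n k"
    using A by (simp add: row_add_def state_iff)
  show ?thesis
    unfolding state_iff
  proof (intro conjI allI impI carrier)
    fix j assume j: "j < k"
    show "row_add x A $$ (lead j, j) = 1"
      using j x by (simp add: row_add_entry[OF A] lead_less_n state_one[OF A] state_zero[OF A])
    show "row_add x A $$ (z, j) = 0" if "z < n" "lead j < z" for z
      using j x that by (simp add: row_add_entry[OF A] state_zero[OF A])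
  qed
qed

sublocale walk: finite_involutions S "{1..<n}" row_add
proof
  show "finite S" by (rule finite_states)
  show "finite {1..<n}" by simp
  fix x A assume x: "x \<in> {1..<n}" and A: "A \<in> S"
  show closed: "row_add x A \<in> S" using x A by (rule row_add_closed)
  show "row_add x (row_add x A) = A"
  proof (rule state_eqI)
    show "row_add x (row_add x A) \<in> S" using x closed by (rule row_add_closed)
    fix z j assume "z < n" "j < k"
    then show "row_add x (row_add x A) $$ (z, j) = A $$ (z, j)"
      using x by (auto simp: row_add_entry[OF A] row_add_entry[OF closed] add.assoc)
  qed (rule A)
qed

lemma minus_walk_generator: "- matrix_walk_generator n f A = walk.lap f A"
proof -
  have "measure_pmf.expectation (row_update x A) f - f A = - ((f A - f (row_add x A)) / 2)" for x
  proof -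
    have "addrow 0 (x - 1) x A = A" by (rule eq_matI) auto
    then show ?thesis
      unfolding row_update_def expectation_fair_bit row_add_def by (simp add: field_simps)
  qed
  then show ?thesis
    unfolding matrix_walk_generator_def clock_generator_def walk.lap_def by (simp add: sum_negf)
qed

definition free :: "nat \<Rightarrow> nat \<Rightarrow> bool" where
  "free i j \<longleftrightarrow> j < k \<and> i < lead j"

definition flip :: "nat \<Rightarrow> nat \<Rightarrow> bit mat \<Rightarrow> bit mat" where
  "flip i j A = mat n k (\<lambda>(z, l). A $$ (z, l) + of_bool (z = i \<and> l = j))"

lemma flip_entry: "z < n \<Longrightarrow> l < k \<Longrightarrow> flip i j A $$ (z, l) = A $$ (z, l) + of_bool (z = i \<and> l = j)"
  by (simp add: flip_def)

lemma flip_closed: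
  assumes "free i j" "A \<in> S"
  shows "flip i j A \<in> S"
  unfolding state_iff
proof (intro conjI allI impI)
  show "flip i j A \<in> carrier_mat n k" by (simp add: flip_def)
qed (use assms in \<open>auto simp: flip_entry lead_less_n state_zero state_one free_def\<close>)

lemma flip_flip: "free i j \<Longrightarrow> A \<in> S \<Longrightarrow> flip i j (flip i j A) = A"
  by (rule state_eqI) (auto simp: flip_closed flip_entry add.assoc)

lemma flip_commute: "free i j \<Longrightarrow> free i l \<Longrightarrow> A \<in> S \<Longrightarrow> flip i j (flip i l A) = flip i l (flip i j A)"
  by (rule state_eqI) (auto simp: flip_closed flip_entry ac_simps)

definition agree_from :: "nat \<Rightarrow> bit mat \<Rightarrow> bit mat \<Rightarrow> bool" where
  "agree_from i A A' \<longleftrightarrow> (\<forall>z<n. i \<le> z \<longrightarrow> (\<forall>j<k. A $$ (z, j) = A' $$ (z, j)))"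

definition ignores_above :: "nat \<Rightarrow> (bit mat \<Rightarrow> real) \<Rightarrow> bool" where
  "ignores_above i f \<longleftrightarrow> (\<forall>A\<in>S. \<forall>A'\<in>S. agree_from i A A' \<longrightarrow> f A = f A')"

definition eigenfunction :: "real \<Rightarrow> (bit mat \<Rightarrow> real) \<Rightarrow> bool" where
  "eigenfunction \<mu> f \<longleftrightarrow> (\<forall>A\<in>S. walk.lap f A = \<mu> * f A)"

text \<open>
  The flip in row \<open>i\<close> commutes with all moves except the one that adds row \<open>i\<close> to row \<open>i - 1\<close>, and
  there the two orders give matrices that differ only in row \<open>i - 1\<close>, which \<open>f\<close> does not see.
\<close>

lemma lap_flip:
  assumes "ignores_above i f" "free i j" "A \<in> S"
  shows "walk.lap (\<lambda>A. f (flip i j A)) A = walk.lap f (flip i j A)"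
proof -
  have "f (flip i j (row_add x A)) = f (row_add x (flip i j A))" if x: "x \<in> {1..<n}" for x
  proof -
    have S: "row_add x A \<in> S" "flip i j A \<in> S"
      "flip i j (row_add x A) \<in> S" "row_add x (flip i j A) \<in> S"
      by (rule row_add_closed[OF x assms(3)] flip_closed[OF assms(2,3)]
          flip_closed[OF assms(2) row_add_closed[OF x assms(3)]]
          row_add_closed[OF x flip_closed[OF assms(2,3)]])+
    have "agree_from i (flip i j (row_add x A)) (row_add x (flip i j A))"
      unfolding agree_from_def using x
      by (auto simp: flip_entry row_add_entry[OF S(2)] row_add_entry[OF assms(3)])
    then show ?thesis using assms(1) S unfolding ignores_above_def by blast
  qed
  then show ?thesis unfolding walk.lap_def by (intro sum.cong) auto
qed

lemma flip_combination:
  assumes "eigenfunction \<mu> f" "ignores_above i f" "free i j"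
  shows "eigenfunction \<mu> (\<lambda>A. 1 * f A + e * f (flip i j A))"
    and "ignores_above i (\<lambda>A. 1 * f A + e * f (flip i j A))"
proof -
  show "eigenfunction \<mu> (\<lambda>A. 1 * f A + e * f (flip i j A))"
    unfolding eigenfunction_def
  proof
    fix A assume A: "A \<in> S"
    show "walk.lap (\<lambda>A. 1 * f A + e * f (flip i j A)) A = \<mu> * (1 * f A + e * f (flip i j A))"
      using assms(1) A flip_closed[OF assms(3) A]
      unfolding walk.lap_lincomb[of 1 f e "\<lambda>A. f (flip i j A)"] lap_flip[OF assms(2,3) A]
      by (simp add: eigenfunction_def algebra_simps)
  qed
  have "agree_from i (flip i j A) (flip i j A')" if "agree_from i A A'" for A A'
    using that by (simp add: agree_from_def flip_entry)
  then show "ignores_above i (\<lambda>A. 1 * f A + e * f (flip i j A))"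
    using assms(2) flip_closed[OF assms(3)] unfolding ignores_above_def by metis
qed

text \<open>
  Row \<open>i\<close> of \<open>A\<close> is changed into row \<open>i\<close> of \<open>A'\<close> by flipping the entries where they differ, one
  at a time; each flip of entry \<open>j\<close> contributes a factor \<open>\<epsilon> j\<close>.
\<close>

lemma row_character:
  assumes g: "ignores_above i g" and i: "i < n"
    and \<epsilon>: "\<And>j A. free i j \<Longrightarrow> A \<in> S \<Longrightarrow> g (flip i j A) = \<epsilon> j * g A"
    and A: "A \<in> S" "A' \<in> S" "agree_from (Suc i) A A'"
  shows "g A' = (\<Prod>j | free i j \<and> A $$ (i, j) \<noteq> A' $$ (i, j). \<epsilon> j) * g A"
proof -
  have "g A' = prod \<epsilon> D * g A"
    if "finite D" "A \<in> S" "agree_from (Suc i) A A'" "D = {j. free i j \<and> A $$ (i, j) \<noteq> A' $$ (i, j)}" for A D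
    using that
  proof (induction D arbitrary: A)
    case empty
    have row: "A $$ (i, j) = A' $$ (i, j)" if "j < k" for j
      using that i state_zero[OF empty(1), of j i] state_zero[OF A(2), of j i]
        state_one[OF empty(1), of j] state_one[OF A(2), of j]
    proof (cases i "lead j" rule: linorder_cases)
      case less
      then show ?thesis using eqset_imp_iff[OF empty(3), of j] that by (simp add: free_def)
    qed simp_all
    have "agree_from i A A'"
      unfolding agree_from_def
    proof (intro allI impI)
      fix z j assume "z < n" "i \<le> z" "j < k"
      then show "A $$ (z, j) = A' $$ (z, j)"
        using row[of j] empty(2) by (cases "z = i") (simp_all add: agree_from_def)
    qed
    then have "g A = g A'"
      using g empty(1) A(2) unfolding ignores_above_def by blast
    then show ?case by simp
  next
    case (insert l D)
    have l: "free i l" "A $$ (i, l) \<noteq> A' $$ (i, l)" using insert.prems(3) by blast+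
    have lk: "l < k" using l(1) by (simp add: free_def)
    let ?B = "flip i l A"
    have B: "?B \<in> S" by (rule flip_closed[OF l(1) insert.prems(1)])
    have agree: "agree_from (Suc i) ?B A'"
      using insert.prems(2) by (auto simp: agree_from_def flip_entry)
    have "?B $$ (i, l) = A' $$ (i, l)"
      using l(2) i lk by (cases "A $$ (i, l)"; cases "A' $$ (i, l)") (simp_all add: flip_entry)
    moreover have "?B $$ (i, j) = A $$ (i, j)" if "j \<noteq> l" "free i j" for j
      using that i by (simp add: flip_entry free_def)
    ultimately have "j \<in> D \<longleftrightarrow> free i j \<and> ?B $$ (i, j) \<noteq> A' $$ (i, j)" for j
      using insert.hyps(2) eqset_imp_iff[OF insert.prems(3), of j] by (cases "j = l") auto
    then have "D = {j. free i j \<and> ?B $$ (i, j) \<noteq> A' $$ (i, j)}" by blast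
    from insert.IH[OF B agree this] show ?case
      using insert.hyps by (simp add: \<epsilon>[OF l(1) insert.prems(1)])
  qed
  moreover have "finite {j. free i j \<and> A $$ (i, j) \<noteq> A' $$ (i, j)}"
    by (rule finite_subset[of _ "{..<k}"]) (auto simp: free_def)
  ultimately show ?thesis using A(1,3) by blast
qed

text \<open>
  Starting from the top row, diagonalise the flips of row \<open>i\<close> in the eigenspace. If all signs are 1,
  the common eigenfunction does not see row \<open>i\<close> either, and the argument moves on to row \<open>i + 1\<close>. It
  must stop with a sign \<open>- 1\<close>, since a function that sees no row is constant and has eigenvalue 0.
\<close>

lemma obtain_sign_character:
  assumes "eigenfunction \<mu> f" "\<exists>A\<in>S. f A \<noteq> 0" "\<mu> \<noteq> 0"
  obtains i g \<epsilon> where "i < n" "eigenfunction \<mu> g" "\<exists>A\<in>S. g A \<noteq> 0" "ignores_above i g"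
    "\<And>j. free i j \<Longrightarrow> \<epsilon> j = 1 \<or> \<epsilon> j = - 1"
    "\<And>j A. free i j \<Longrightarrow> A \<in> S \<Longrightarrow> g (flip i j A) = \<epsilon> j * g A"
    "\<exists>j. free i j \<and> \<epsilon> j = - 1"
proof (rule ccontr)
  assume none: "\<not> thesis"
  have "i \<le> n \<Longrightarrow> \<exists>f. eigenfunction \<mu> f \<and> (\<exists>A\<in>S. f A \<noteq> 0) \<and> ignores_above i f" for i
  proof (induction i)
    case 0
    have "ignores_above 0 f"
      unfolding ignores_above_def agree_from_def
    proof (intro ballI impI arg_cong[where f = f] state_eqI)
    qed simp_all
    with assms(1,2) show ?case by (intro exI[of _ f] conjI)
  next
    case (Suc i)
    from Suc.IH[OF Suc_leD[OF Suc.prems]]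
    obtain f where f: "eigenfunction \<mu> f \<and> ignores_above i f" "\<exists>A\<in>S. f A \<noteq> 0"
      by (elim exE conjE) (rule that; simp)
    have fin: "finite {j. free i j}"
      by (rule finite_subset[of _ "{..<k}"]) (auto simp: free_def)
    have "\<exists>g \<epsilon>. (eigenfunction \<mu> g \<and> ignores_above i g) \<and> (\<exists>s\<in>S. g s \<noteq> 0) \<and>
      (\<forall>j\<in>{j. free i j}. (\<epsilon> j = 1 \<or> \<epsilon> j = - 1) \<and> (\<forall>s\<in>S. g (flip i j s) = \<epsilon> j * g s))"
    proof (rule simultaneous_sign_eigenfunction[where V = "\<lambda>f. eigenfunction \<mu> f \<and> ignores_above i f",
          OF fin _ _ _ _ f])
      show "eigenfunction \<mu> (\<lambda>A. 1 * h A + e * h (flip i j A)) \<and>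
          ignores_above i (\<lambda>A. 1 * h A + e * h (flip i j A))"
        if "eigenfunction \<mu> h \<and> ignores_above i h" "j \<in> {j. free i j}" for h e j
        using flip_combination[OF conjunct1[OF that(1)] conjunct2[OF that(1)]] that(2)
        by (intro conjI) (simp_all only: mem_Collect_eq)
      show "flip i j A \<in> S" "flip i j (flip i j A) = A" if "j \<in> {j. free i j}" "A \<in> S" for j A
        using that flip_closed flip_flip by (simp_all only: mem_Collect_eq)
      show "flip i j (flip i l A) = flip i l (flip i j A)"
        if "j \<in> {j. free i j}" "l \<in> {j. free i j}" "A \<in> S" for j l A
        using that by (intro flip_commute) simp_all
    qed
    then obtain g \<epsilon> where g: "eigenfunction \<mu> g" "ignores_above i g" "\<exists>A\<in>S. g A \<noteq> 0"
      and "\<forall>j\<in>{j. free i j}. (\<epsilon> j = 1 \<or> \<epsilon> j = - 1) \<and> (\<forall>s\<in>S. g (flip i j s) = \<epsilon> j * g s)"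
      by (elim exE conjE)
    then have \<epsilon>: "\<And>j. free i j \<Longrightarrow> \<epsilon> j = 1 \<or> \<epsilon> j = - 1"
      "\<And>j A. free i j \<Longrightarrow> A \<in> S \<Longrightarrow> g (flip i j A) = \<epsilon> j * g A" by simp_all
    have i: "i < n" using Suc.prems by simp
    have "\<not> (\<exists>j. free i j \<and> \<epsilon> j = - 1)"
    proof
      assume "\<exists>j. free i j \<and> \<epsilon> j = - 1"
      from that[OF i g(1,3,2) \<epsilon> this] none show False by contradiction
    qed
    then have one: "\<epsilon> j = 1" if "free i j" for j using \<epsilon>(1)[OF that] that by blast
    have "ignores_above (Suc i) g"
      unfolding ignores_above_def
    proof (intro ballI impI)
      fix A A' assume "A \<in> S" "A' \<in> S" "agree_from (Suc i) A A'"
      from row_character[where g = g and i = i and \<epsilon> = \<epsilon>, OF g(2) i \<epsilon>(2) this] show "g A = g A'"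
        by (simp add: one)
    qed
    with g(1,3) show ?case by (intro exI[of _ g] conjI)
  qed
  from this[OF order_refl] obtain f
    where f: "eigenfunction \<mu> f" "\<exists>A\<in>S. f A \<noteq> 0" "ignores_above n f"
    by (elim exE conjE)
  have const: "f A = f A'" if "A \<in> S" "A' \<in> S" for A A'
  proof -
    have "agree_from n A A'" by (simp add: agree_from_def)
    then show ?thesis using f(3) that unfolding ignores_above_def by blast
  qed
  obtain A where A: "A \<in> S" "f A \<noteq> 0" using f(2) by blast
  have "walk.lap f A = 0"
    unfolding walk.lap_def
  proof (rule sum.neutral, rule ballI)
    fix x assume "x \<in> {1..<n}"
    then show "(f A - f (row_add x A)) / 2 = 0"
      using const[OF A(1) row_add_closed[OF _ A(1)]] by simp
  qed
  moreover have "walk.lap f A = \<mu> * f A" using f(1) A(1) by (simp only: eigenfunction_def)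
  ultimately show False using A(2) assms(3) by simp
qed

end

section \<open>Sums of columns as East configurations\<close>

text \<open>
  Sums over \<open>\<F>\<^sub>2\<close> are handled by their group laws; rewriting them to Boolean operations would hide
  these.
\<close>

declare add_bit_eq_xor [simp del]

lemma bit_add_self [simp]: "a + a = 0" "a + (a + c) = c" for a c :: bit
  by (cases a; simp; cases c; simp)+

text \<open>
  A row \<open>i\<close> together with a nonempty set \<open>b\<close> of columns whose entries in that row are free: the data of
  a nontrivial character of row \<open>i\<close>.
\<close>

locale column_sector = column_walk +
  fixes i :: nat and b :: "nat set"
  assumes b_nonempty: "b \<noteq> {}" and b_free: "\<And>j. j \<in> b \<Longrightarrow> free i j"
begin

definition last_col :: nat where "last_col = Max b"

definition height :: nat where "height = lead last_col"

definition col_sum :: "bit mat \<Rightarrow> nat \<Rightarrow> bit" where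
  "col_sum A z = (\<Sum>j\<in>b. A $$ (z, j))"

text \<open>
  The sum of the columns in \<open>b\<close> has its lowest 1 in row \<open>height\<close>. This 1 plays the role of the boundary
  condition to the left of the first spin; spin \<open>y\<close> sits \<open>y\<close> rows above it, and row \<open>i\<close> is the last spin.
  Adding 1 translates the constraint "the row below is 1" into "the spin to the left is 0".
\<close>

definition spins :: "bit mat \<Rightarrow> nat \<Rightarrow> bit" where
  "spins A = restrict (\<lambda>y. 1 + col_sum A (height - y)) {1..height - i}"

lemma finite_b: "finite b"
  by (rule finite_subset[of _ "{..<k}"]) (use b_free in \<open>auto simp: free_def\<close>)

lemma last_col_in: "last_col \<in> b"
  unfolding last_col_def using finite_b b_nonempty by (rule Max_in)

lemma last_col_less: "last_col < k" and i_less_height: "i < height"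
  using b_free[OF last_col_in] by (simp_all add: free_def height_def)

lemma height_less: "height < n"
  unfolding height_def by (rule lead_less_n[OF last_col_less])

lemma col_less: "j \<in> b \<Longrightarrow> j < k"
  using b_free[of j] by (simp add: free_def)

lemma lead_less_height:
  assumes "j \<in> b" "j \<noteq> last_col"
  shows "lead j < height"
  unfolding height_def
proof (rule lead_strict_mono[OF _ last_col_less])
  show "j < last_col" using assms Max_ge[OF finite_b assms(1)] by (simp add: last_col_def)
qed

lemma col_sum_split: "col_sum A z = A $$ (z, last_col) + (\<Sum>j\<in>b - {last_col}. A $$ (z, j))"
  unfolding col_sum_def by (rule sum.remove[OF finite_b last_col_in])

lemma col_sum_height:
  assumes "A \<in> S"
  shows "col_sum A height = 1"
proof -
  have "(\<Sum>j\<in>b - {last_col}. A $$ (height, j)) = 0"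
  proof (rule sum.neutral, rule ballI)
    fix j assume "j \<in> b - {last_col}"
    then show "A $$ (height, j) = 0"
      using assms col_less lead_less_height height_less by (intro state_zero) auto
  qed
  then show ?thesis
    unfolding col_sum_split using state_one[OF assms last_col_less] by (simp add: height_def)
qed

lemma col_sum_row_add:
  assumes "A \<in> S" "z < n"
  shows "col_sum (row_add x A) z = col_sum A z + (if z = x - 1 then col_sum A x else 0)"
proof -
  have "col_sum (row_add x A) z = (\<Sum>j\<in>b. A $$ (z, j) + (if z = x - 1 then A $$ (x, j) else 0))"
    unfolding col_sum_def by (rule sum.cong) (simp_all add: row_add_entry[OF assms] col_less)
  then show ?thesis by (simp add: col_sum_def sum.distrib)
qed

lemma spins_in: "spins A \<in> east_configs (height - i)"
  unfolding spins_def east_configs_iff by (simp add: restrict_def)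

lemma spins_at: "y \<in> {1..height - i} \<Longrightarrow> spins A y = 1 + col_sum A (height - y)"
  unfolding spins_def by simp

lemma spins_outside: "y \<notin> {1..height - i} \<Longrightarrow> spins A y = undefined"
  by (simp only: spins_def restrict_def if_False)

lemma facilitated_iff:
  assumes "A \<in> S" "y \<in> {1..height - i}"
  shows "(y = 1 \<or> (y \<ge> 2 \<and> spins A (y - 1) = 0)) \<longleftrightarrow> col_sum A (Suc (height - y)) = 1"
proof (cases "y = 1")
  case True
  then show ?thesis using col_sum_height[OF assms(1)] i_less_height by simp
next
  case False
  then have y: "y \<ge> 2" "y - 1 \<in> {1..height - i}" "height - (y - 1) = Suc (height - y)"
    using assms(2) by auto
  show ?thesis
    using y(1) False unfolding spins_at[OF y(2)] y(3)
    by (cases "col_sum A (Suc (height - y))") simp_all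
qed

lemma spins_row_add:
  assumes "A \<in> S" "y \<in> {1..height - i}"
  shows "spins (row_add (Suc (height - y)) A) = east_flip y (spins A)"
proof
  fix w
  show "spins (row_add (Suc (height - y)) A) w = east_flip y (spins A) w"
  proof (cases "w \<in> {1..height - i}")
    case w: True
    have same: "height - w = Suc (height - y) - 1 \<longleftrightarrow> w = y" using w assms(2) by auto
    have "height - w < n" using height_less by simp
    then have "spins (row_add (Suc (height - y)) A) w
        = spins A w + (if w = y then col_sum A (Suc (height - y)) else 0)"
      unfolding spins_at[OF w] using assms(1) same by (simp add: col_sum_row_add add.assoc del: diff_Suc_1)
    also have "\<dots> = east_flip y (spins A) w"
      unfolding east_flip_def facilitated_iff[OF assms]
      by (cases "col_sum A (Suc (height - y))") simp_all
    finally show ?thesis .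
  next
    case False
    then have "w \<noteq> y" using assms(2) by auto
    then show ?thesis using False by (auto simp: spins_def east_flip_def)
  qed
qed

lemma spins_row_add_idle:
  assumes "A \<in> S" "x \<noteq> 0" "x \<notin> {Suc i..height}"
  shows "spins (row_add x A) = spins A"
proof
  fix w
  show "spins (row_add x A) w = spins A w"
  proof (cases "w \<in> {1..height - i}")
    case w: True
    then have "height - w \<noteq> x - 1" "height - w < n" using assms(2,3) height_less by auto
    then show ?thesis unfolding spins_at[OF w] using assms(1) by (simp add: col_sum_row_add)
  next
    case False
    then show ?thesis by (simp only: spins_outside not_False_eq_True)
  qed
qed

text \<open>
  The flip changes the column sum in row \<open>i\<close> only, and row \<open>i\<close> is the last spin.
\<close>

lemma flip_last_col:
  assumes "A \<in> S"
  shows "spins (flip i last_col A) = (spins A)(height - i := spins A (height - i) + 1)"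
proof
  fix w
  have top: "height - i \<in> {1..height - i}" using i_less_height by simp
  show "spins (flip i last_col A) w = ((spins A)(height - i := spins A (height - i) + 1)) w"
  proof (cases "w \<in> {1..height - i}")
    case w: True
    have "col_sum (flip i last_col A) z = col_sum A z + of_bool (z = i)" if "z < n" for z
    proof -
      have "(\<Sum>j\<in>b - {last_col}. flip i last_col A $$ (z, j)) = (\<Sum>j\<in>b - {last_col}. A $$ (z, j))"
        using that col_less by (intro sum.cong) (auto simp: flip_entry)
      then show ?thesis
        unfolding col_sum_split using that last_col_less by (simp add: flip_entry ac_simps)
    qed
    moreover have "height - w < n" using height_less by simp
    moreover have "height - w = i \<longleftrightarrow> w = height - i" using w i_less_height by auto
    ultimately show ?thesis
      using spins_at[OF w] spins_at[OF top] by (simp add: add.assoc)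
  next
    case False
    then have "w \<noteq> height - i" using top by metis
    then show ?thesis using False by (simp only: spins_outside fun_upd_other not_False_eq_True)
  qed
qed

text \<open>
  The last column of \<open>b\<close> is free in the rows \<open>i\<close> to \<open>height - 1\<close>, so it can correct the sum of the
  other columns to any prescribed configuration.
\<close>

lemma spins_surj: "spins ` S = east_configs (height - i)"
proof (intro equalityI subsetI)
  fix \<sigma> assume \<sigma>: "\<sigma> \<in> east_configs (height - i)"
  obtain A0 where A0: "A0 \<in> S" using states_nonempty by blast
  define A where "A = mat n k (\<lambda>(z, j). if j = last_col \<and> i \<le> z \<and> z < height
    then 1 + \<sigma> (height - z) + (\<Sum>l\<in>b - {last_col}. A0 $$ (z, l)) else A0 $$ (z, j))"
  have entry: "A $$ (z, j) = (if j = last_col \<and> i \<le> z \<and> z < height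
    then 1 + \<sigma> (height - z) + (\<Sum>l\<in>b - {last_col}. A0 $$ (z, l)) else A0 $$ (z, j))"
    if "z < n" "j < k" for z j
    using that by (simp add: A_def)
  have A: "A \<in> S"
    unfolding state_iff
  proof (intro conjI allI impI)
    show "A \<in> carrier_mat n k" by (simp add: A_def)
    fix j assume j: "j < k"
    show "A $$ (lead j, j) = 1"
      using j state_one[OF A0 j] lead_less_n[OF j]
      by (cases "j = last_col") (simp_all add: entry height_def)
    show "A $$ (z, j) = 0" if "z < n" "lead j < z" for z
      using that j state_zero[OF A0 j that]
      by (cases "j = last_col") (simp_all add: entry height_def)
  qed
  have "spins A = \<sigma>"
  proof
    fix w
    show "spins A w = \<sigma> w"
    proof (cases "w \<in> {1..height - i}")
      case w: True
      then have z: "height - w < n" "i \<le> height - w" "height - w < height" "height - (height - w) = w"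
        using height_less i_less_height by auto
      have "(\<Sum>j\<in>b - {last_col}. A $$ (height - w, j)) = (\<Sum>j\<in>b - {last_col}. A0 $$ (height - w, j))"
        using z(1) col_less by (intro sum.cong) (auto simp: entry)
      then have "col_sum A (height - w) = 1 + \<sigma> w"
        unfolding col_sum_split entry[OF z(1) last_col_less] using z(2-4) by (simp add: add.assoc)
      then show ?thesis unfolding spins_at[OF w] by (simp only: add.assoc[symmetric]) simp
    next
      case False
      then show ?thesis using \<sigma> spins_outside[OF False] by (simp add: east_configs_iff)
    qed
  qed
  then show "\<sigma> \<in> spins ` S" using A by blast
qed (use spins_in in blast)

lemma row_of_spin: "(\<lambda>y. Suc (height - y)) ` {1..height - i} = {Suc i..height}"
proof (intro equalityI subsetI)
  fix x assume "x \<in> {Suc i..height}"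
  then show "x \<in> (\<lambda>y. Suc (height - y)) ` {1..height - i}"
    by (intro image_eqI[of _ _ "Suc height - x"]) auto
qed (use i_less_height in auto)

lemma row_of_spin_inj: "inj_on (\<lambda>y. Suc (height - y)) {1..height - i}"
  by (rule inj_onI) auto

lemma east_eigenvalue_of_walk:
  assumes "eigenvalue_on (east_configs (height - i)) (laplacian {1..height - i} east_flip) \<mu>"
  shows "eigenvalue_on S walk.lap \<mu>"
proof (rule eigenvalue_pullback[OF walk.finite_involutions_axioms east.finite_involutions_axioms
      spins_surj row_of_spin_inj _ _ _ assms])
  show "(\<lambda>y. Suc (height - y)) ` {1..height - i} \<subseteq> {1..<n}"
    unfolding row_of_spin using height_less by auto
  show "spins (row_add x A) = spins A"
    if "x \<in> {1..<n}" "x \<notin> (\<lambda>y. Suc (height - y)) ` {1..height - i}" "A \<in> S" for x A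
    using that unfolding row_of_spin by (intro spins_row_add_idle) auto
qed (rule spins_row_add)

text \<open>
  The comparison of the matrix walk with the East process. At a matrix \<open>A\<close> that maximises \<open>\<bar>g\<bar>\<close> over its
  fibre, the eigenvalue equation for \<open>g\<close> is compared move by move with the East generator applied to
  \<open>\<phi>\<close>. The rows above \<open>i\<close> do not move \<open>g\<close>; row \<open>i\<close> flips the sign of \<open>g\<close> exactly when the last spin is
  facilitated, which is when it flips the sign of \<open>\<phi>\<close>; the other rows lead to matrices where \<open>\<bar>g\<bar>\<close> is
  at most the value of \<open>\<psi>\<close> in their fibre.
\<close>

lemma east_eigenvalue_below:
  assumes g: "eigenfunction \<mu> g" "\<exists>A\<in>S. g A \<noteq> 0" "ignores_above i g"
    and \<epsilon>: "\<And>j. free i j \<Longrightarrow> \<epsilon> j = 1 \<or> \<epsilon> j = - 1"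
      "\<And>j A. free i j \<Longrightarrow> A \<in> S \<Longrightarrow> g (flip i j A) = \<epsilon> j * g A"
    and b: "b = {j. free i j \<and> \<epsilon> j = - 1}"
  shows "\<exists>\<nu>. 0 < \<nu> \<and> \<nu> \<le> \<mu> \<and>
    eigenvalue_on (east_configs (height - i)) (laplacian {1..height - i} east_flip) \<nu>"
proof -
  define p where "p = height - i"
  let ?E = "east_configs p"
  have p: "p \<in> {1..p}" using i_less_height by (simp add: p_def)
  have i_n: "i < n" using i_less_height height_less by simp
  define \<psi> where "\<psi> \<sigma> = Max ((\<lambda>A. \<bar>g A\<bar>) ` {A\<in>S. spins A = \<sigma>})" for \<sigma>
  have psi_ge: "\<bar>g A\<bar> \<le> \<psi> (spins A)" if "A \<in> S" for A
    unfolding \<psi>_def using finite_states that by (intro Max_ge) auto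
  have psi_attained: "\<exists>A\<in>S. spins A = \<sigma> \<and> \<bar>g A\<bar> = \<psi> \<sigma>" if \<sigma>: "\<sigma> \<in> ?E" for \<sigma>
  proof -
    have "\<sigma> \<in> spins ` S" using \<sigma> by (simp only: p_def spins_surj)
    then obtain A where A: "A \<in> S" "spins A = \<sigma>" by blast
    have "\<psi> \<sigma> \<in> (\<lambda>A. \<bar>g A\<bar>) ` {A\<in>S. spins A = \<sigma>}"
      unfolding \<psi>_def
    proof (rule Max_in)
      show "finite ((\<lambda>A. \<bar>g A\<bar>) ` {A\<in>S. spins A = \<sigma>})" using finite_states by simp
      show "(\<lambda>A. \<bar>g A\<bar>) ` {A\<in>S. spins A = \<sigma>} \<noteq> {}" using A by blast
    qed
    then show ?thesis by (elim imageE CollectE conjE) (intro bexI conjI; simp)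
  qed
  define top where "top \<sigma> = \<sigma>(p := \<sigma> p + (1 :: bit))" for \<sigma> :: "nat \<Rightarrow> bit"
  have top_in: "top \<sigma> \<in> ?E" if "\<sigma> \<in> ?E" for \<sigma>
    using that p by (auto simp: top_def east_configs_iff)
  have top_top: "top (top \<sigma>) = \<sigma>" for \<sigma> by (simp add: top_def add.assoc)
  \<comment> \<open>\<psi> is independent of the last spin, since flipping an entry of row i preserves the modulus of g.\<close>
  have psi_top_le: "\<psi> \<sigma> \<le> \<psi> (top \<sigma>)" if \<sigma>: "\<sigma> \<in> ?E" for \<sigma>
  proof -
    obtain A where A: "A \<in> S" "spins A = \<sigma>" "\<bar>g A\<bar> = \<psi> \<sigma>" using psi_attained[OF \<sigma>] by blast
    have l: "free i last_col" by (rule b_free[OF last_col_in])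
    have "\<bar>g (flip i last_col A)\<bar> = \<psi> \<sigma>"
      using \<epsilon>(1)[OF l] \<epsilon>(2)[OF l A(1)] A(3) by auto
    moreover have "spins (flip i last_col A) = top \<sigma>"
      unfolding flip_last_col[OF A(1)] A(2) top_def p_def ..
    ultimately show ?thesis using psi_ge[OF flip_closed[OF l A(1)]] by simp
  qed
  have psi_top: "\<psi> (top \<sigma>) = \<psi> \<sigma>" if "\<sigma> \<in> ?E" for \<sigma>
    using psi_top_le[OF that] psi_top_le[OF top_in[OF that]] by (simp add: top_top)
  define sg :: "(nat \<Rightarrow> bit) \<Rightarrow> real" where "sg \<sigma> = (if \<sigma> p = 0 then 1 else - 1)" for \<sigma>
  have sg_top: "sg (top \<sigma>) = - sg \<sigma>" for \<sigma> by (cases "\<sigma> p") (simp_all add: sg_def top_def)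
  have sg_sq: "sg \<sigma> * sg \<sigma> = 1" for \<sigma> by (simp add: sg_def)
  define \<phi> where "\<phi> \<sigma> = sg \<sigma> * \<psi> \<sigma>" for \<sigma>
  have "sum \<phi> ?E = (\<Sum>\<sigma>\<in>?E. \<phi> (top \<sigma>))"
    by (rule sum.reindex_bij_witness[of _ top top]) (simp_all add: top_in top_top)
  also have "\<dots> = (\<Sum>\<sigma>\<in>?E. - \<phi> \<sigma>)"
    by (rule sum.cong) (simp_all add: \<phi>_def sg_top psi_top)
  also have "\<dots> = - sum \<phi> ?E" by (rule sum_negf)
  finally have mean_zero: "sum \<phi> ?E = 0" by simp
  have nonzero: "\<exists>\<sigma>\<in>?E. \<phi> \<sigma> \<noteq> 0"
  proof -
    obtain A where A: "A \<in> S" "g A \<noteq> 0" using g(2) by blast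
    then have "\<psi> (spins A) \<noteq> 0" using psi_ge[OF A(1)] by auto
    then have "\<phi> (spins A) \<noteq> 0" by (simp add: \<phi>_def sg_def)
    then show ?thesis using spins_in p_def by blast
  qed
  \<comment> \<open>The sign is the product of \<epsilon> over the 1s of row i + 1, whose parity on b is the entry of the column sum.\<close>
  have row_i: "g (row_add (Suc i) A) = (if col_sum A (Suc i) = 1 then - g A else g A)"
    if A: "A \<in> S" for A
  proof -
    have Si: "Suc i < n" "Suc i \<in> {1..<n}" using i_less_height height_less by auto
    have A': "row_add (Suc i) A \<in> S" by (rule row_add_closed[OF Si(2) A])
    have "agree_from (Suc i) A (row_add (Suc i) A)"
      unfolding agree_from_def by (simp add: row_add_entry[OF A])
    note rc = row_character[where g = g and i = i and \<epsilon> = \<epsilon>, OF g(3) i_n \<epsilon>(2) A A' this]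
    have diff: "A $$ (i, j) \<noteq> row_add (Suc i) A $$ (i, j) \<longleftrightarrow> A $$ (Suc i, j) = 1" if "free i j" for j
      using that i_n by (cases "A $$ (Suc i, j)"; cases "A $$ (i, j)")
        (simp_all add: row_add_entry[OF A] free_def)
    define D where "D = {j. free i j \<and> A $$ (Suc i, j) = 1}"
    have finD: "finite D" unfolding D_def
      by (rule finite_subset[of _ "{..<k}"]) (auto simp: free_def)
    have "{j. free i j \<and> A $$ (i, j) \<noteq> row_add (Suc i) A $$ (i, j)} = D"
      unfolding D_def using diff by blast
    then have gD: "g (row_add (Suc i) A) = prod \<epsilon> D * g A" using rc by simp
    have "prod \<epsilon> D = prod \<epsilon> (D \<inter> b)"
    proof (rule prod.mono_neutral_right[OF finD])
      show "\<forall>j\<in>D - D \<inter> b. \<epsilon> j = 1" using \<epsilon>(1) unfolding b D_def by blast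
    qed simp
    also have "\<dots> = (- 1) ^ card (D \<inter> b)" by (simp add: b)
    finally have pD: "prod \<epsilon> D = (- 1) ^ card (D \<inter> b)" .
    have parity: "(\<Sum>j\<in>c. A $$ (Suc i, j)) = of_bool (odd (card {j\<in>c. A $$ (Suc i, j) = 1}))"
      if "finite c" for c
      using that
    proof (induction c)
      case (insert l c)
      have "{j \<in> insert l c. A $$ (Suc i, j) = 1} =
          (if A $$ (Suc i, l) = 1 then insert l {j\<in>c. A $$ (Suc i, j) = 1}
           else {j\<in>c. A $$ (Suc i, j) = 1})" by auto
      then show ?case
        using insert by (cases "A $$ (Suc i, l)") simp_all
    qed simp
    have "{j\<in>b. A $$ (Suc i, j) = 1} = D \<inter> b" using b_free unfolding D_def by blast
    then have "col_sum A (Suc i) = of_bool (odd (card (D \<inter> b)))"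
      using parity[OF finite_b] by (simp add: col_sum_def)
    then show ?thesis using gD pD by (cases "odd (card (D \<inter> b))") simp_all
  qed
  have pointwise: "\<phi> \<sigma> * laplacian {1..p} east_flip \<phi> \<sigma> \<le> \<mu> * (\<phi> \<sigma> * \<phi> \<sigma>)" if \<sigma>: "\<sigma> \<in> ?E" for \<sigma>
  proof -
    obtain A where A: "A \<in> S" "spins A = \<sigma>" "\<bar>g A\<bar> = \<psi> \<sigma>" using psi_attained[OF \<sigma>] by blast
    have psi_nonneg: "0 \<le> \<psi> \<sigma>" using A(3) by linarith
    \<comment> \<open>The contribution of clock x to the eigenvalue equation at A, after multiplication by the sign of g A.\<close>
    define h where "h x = (\<psi> \<sigma> - sgn (g A) * g (row_add x A)) / 2" for x
    have sgn_le: "sgn (g A) * r \<le> \<bar>r\<bar>" for r by (simp add: sgn_if abs_if)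
    have g_step: "sgn (g A) * g (row_add x A) \<le> \<psi> (spins (row_add x A))" if "x \<in> {1..<n}" for x
      using sgn_le[of "g (row_add x A)"] psi_ge[OF row_add_closed[OF that A(1)]] by linarith
    have sgA: "sgn (g A) * g A = \<psi> \<sigma>" using A(3) by (simp add: abs_sgn mult.commute)
    have "\<mu> * \<psi> \<sigma> = sgn (g A) * walk.lap g A"
      using g(1) A(1) sgA unfolding eigenfunction_def by simp
    also have "\<dots> = (\<Sum>x\<in>{1..<n}. h x)"
      unfolding walk.lap_def h_def sum_distrib_left
      by (rule sum.cong) (simp_all add: right_diff_distrib sgA)
    also have "\<dots> \<ge> (\<Sum>x\<in>{Suc i..height}. h x)"
    proof (rule sum_mono2)
      show "{Suc i..height} \<subseteq> {1..<n}" using height_less by auto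
      fix x assume x: "x \<in> {1..<n} - {Suc i..height}"
      then have "spins (row_add x A) = \<sigma>"
        using spins_row_add_idle[OF A(1), of x] A(2) by auto
      then show "0 \<le> h x" using g_step[of x] x by (simp add: h_def)
    qed simp
    finally have upper: "(\<Sum>x\<in>{Suc i..height}. h x) \<le> \<mu> * \<psi> \<sigma>" .
    have "sg \<sigma> * laplacian {1..p} east_flip \<phi> \<sigma> = (\<Sum>y\<in>{1..p}. (\<psi> \<sigma> - sg \<sigma> * \<phi> (east_flip y \<sigma>)) / 2)"
      unfolding east.lap_def sum_distrib_left
      by (rule sum.cong) (simp_all add: right_diff_distrib \<phi>_def mult.assoc[symmetric] sg_sq)
    also have "\<dots> \<le> (\<Sum>y\<in>{1..p}. h (Suc (height - y)))"
    proof (rule sum_mono)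
      fix y assume y: "y \<in> {1..p}"
      have x: "Suc (height - y) \<in> {1..<n}" using y height_less by (auto simp: p_def)
      have step: "spins (row_add (Suc (height - y)) A) = east_flip y \<sigma>"
        using spins_row_add[OF A(1), of y] y A(2) by (simp add: p_def)
      have "sgn (g A) * g (row_add (Suc (height - y)) A) \<le> sg \<sigma> * \<phi> (east_flip y \<sigma>)"
      proof (cases "y = p")
        case False
        then have "sg (east_flip y \<sigma>) = sg \<sigma>" by (simp add: sg_def east_flip_def)
        then have "sg \<sigma> * \<phi> (east_flip y \<sigma>) = \<psi> (east_flip y \<sigma>)"
          by (simp add: \<phi>_def mult.assoc[symmetric] sg_sq)
        then show ?thesis using g_step[OF x] step by simp
      next
        case True
        then have hi: "height - y = i" using i_less_height by (simp add: p_def)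
        have fac: "(y = 1 \<or> (y \<ge> 2 \<and> \<sigma> (y - 1) = 0)) \<longleftrightarrow> col_sum A (Suc i) = 1"
          using facilitated_iff[OF A(1), of y] y A(2) hi by (simp add: p_def)
        show ?thesis
        proof (cases "col_sum A (Suc i) = 1")
          case c: True
          have "east_flip y \<sigma> = \<sigma>(y := \<sigma> y + 1)"
            unfolding east_flip_def by (rule if_P) (use fac c in blast)
          then have "east_flip y \<sigma> = top \<sigma>" by (simp only: top_def True)
          then have "sg \<sigma> * \<phi> (east_flip y \<sigma>) = - \<psi> \<sigma>"
            using psi_top[OF \<sigma>] sg_sq[of \<sigma>] by (simp add: \<phi>_def sg_top mult.assoc[symmetric])
          then show ?thesis using c sgA by (simp add: hi row_i[OF A(1)])
        next
          case c: False
          have "east_flip y \<sigma> = \<sigma>"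
            unfolding east_flip_def by (rule if_not_P) (use fac c in blast)
          then have "sg \<sigma> * \<phi> (east_flip y \<sigma>) = \<psi> \<sigma>"
            by (simp add: \<phi>_def mult.assoc[symmetric] sg_sq)
          then show ?thesis using c sgA by (simp add: hi row_i[OF A(1)])
        qed
      qed
      then show "(\<psi> \<sigma> - sg \<sigma> * \<phi> (east_flip y \<sigma>)) / 2 \<le> h (Suc (height - y))"
        by (simp add: h_def)
    qed
    also have "\<dots> = (\<Sum>x\<in>{Suc i..height}. h x)"
      unfolding row_of_spin[symmetric] p_def
      by (subst sum.reindex[OF row_of_spin_inj]) simp
    also note upper
    finally have "sg \<sigma> * laplacian {1..p} east_flip \<phi> \<sigma> \<le> \<mu> * \<psi> \<sigma>" .
    from mult_left_mono[OF this psi_nonneg]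
    have "\<psi> \<sigma> * (sg \<sigma> * laplacian {1..p} east_flip \<phi> \<sigma>) \<le> \<psi> \<sigma> * (\<mu> * \<psi> \<sigma>)" .
    moreover have "\<phi> \<sigma> * \<phi> \<sigma> = (sg \<sigma> * sg \<sigma>) * (\<psi> \<sigma> * \<psi> \<sigma>)"
      by (simp only: \<phi>_def ac_simps)
    then have "\<mu> * (\<phi> \<sigma> * \<phi> \<sigma>) = \<psi> \<sigma> * (\<mu> * \<psi> \<sigma>)" by (simp add: sg_sq)
    moreover have "\<phi> \<sigma> * laplacian {1..p} east_flip \<phi> \<sigma>
        = \<psi> \<sigma> * (sg \<sigma> * laplacian {1..p} east_flip \<phi> \<sigma>)"
      by (simp only: \<phi>_def ac_simps)
    ultimately show ?thesis by (simp only:)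
  qed
  have "east.ip p \<phi> (laplacian {1..p} east_flip \<phi>) \<le> \<mu> * east.ip p \<phi> \<phi>"
    unfolding east.ip_def sum_distrib_left by (rule sum_mono) (rule pointwise)
  from east.eigenvalue_below_rayleigh_quotient[OF _ mean_zero nonzero this]
  show ?thesis unfolding p_def[symmetric] using east_irreducible[of p] by blast
qed

end

section \<open>Comparison of the spectral gaps\<close>

lemma Least_eq_if_coinitial:
  fixes P Q :: "'a::order \<Rightarrow> bool"
  assumes QP: "\<And>x. Q x \<Longrightarrow> P x" and PQ: "\<And>x. P x \<Longrightarrow> \<exists>y. Q y \<and> y \<le> x"
  shows "(LEAST x. P x) = (LEAST x. Q x)"
proof -
  have "P x \<and> (\<forall>y. P y \<longrightarrow> x \<le> y) \<longleftrightarrow> Q x \<and> (\<forall>y. Q y \<longrightarrow> x \<le> y)" for x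
  proof
    assume x: "P x \<and> (\<forall>y. P y \<longrightarrow> x \<le> y)"
    then obtain y where "Q y" "y \<le> x" using PQ by blast
    then have "y = x" using x QP by (intro antisym) auto
    then show "Q x \<and> (\<forall>y. Q y \<longrightarrow> x \<le> y)" using \<open>Q y\<close> x QP by blast
  next
    assume x: "Q x \<and> (\<forall>y. Q y \<longrightarrow> x \<le> y)"
    then show "P x \<and> (\<forall>y. P y \<longrightarrow> x \<le> y)" using QP PQ by (meson order_trans)
  qed
  then show ?thesis unfolding Least_def by simp
qed

lemma card_east_configs: "card (east_configs m) = 2 ^ m"
  unfolding east_configs_def by (subst card_PiE) (simp_all add: numeral_2_eq_2)

context column_walk
begin

lemma east_eigenvalue_below_walk_eigenvalue:
  assumes "eigenvalue_on S walk.lap \<mu>" "0 < \<mu>"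
  shows "\<exists>\<nu>. (0 < \<nu> \<and> eigenvalue_on (east_configs (last cs - 1)) (laplacian {1..last cs - 1} east_flip) \<nu>)
    \<and> \<nu> \<le> \<mu>"
proof -
  obtain f where f: "eigenfunction \<mu> f" "\<exists>A\<in>S. f A \<noteq> 0"
    using assms(1) unfolding eigenvalue_on_def eigenfunction_def by blast
  obtain i g \<epsilon> where "i < n" and g: "eigenfunction \<mu> g" "\<exists>A\<in>S. g A \<noteq> 0" "ignores_above i g"
    and \<epsilon>: "\<And>j. free i j \<Longrightarrow> \<epsilon> j = 1 \<or> \<epsilon> j = - 1"
      "\<And>j A. free i j \<Longrightarrow> A \<in> S \<Longrightarrow> g (flip i j A) = \<epsilon> j * g A"
    and ex: "\<exists>j. free i j \<and> \<epsilon> j = - 1"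
    by (rule obtain_sign_character[OF f less_imp_neq[OF assms(2), symmetric]])
      (rule that, assumption+)
  define b where "b = {j. free i j \<and> \<epsilon> j = - 1}"
  interpret column_sector n cs i b
    by unfold_locales (use ex in \<open>auto simp: b_def\<close>)
  obtain \<nu> where \<nu>: "0 < \<nu>" "\<nu> \<le> \<mu>"
    "eigenvalue_on (east_configs (height - i)) (laplacian {1..height - i} east_flip) \<nu>"
    using east_eigenvalue_below[OF g \<epsilon> b_def] by blast
  have "height \<le> last cs - 1"
    using lead_mono[of last_col "k - 1"] last_col_less cs_nonempty
    by (simp add: height_def last_conv_nth lead_def)
  then have "eigenvalue_on (east_configs (last cs - 1)) (laplacian {1..last cs - 1} east_flip) \<nu>"
    by (intro east_eigenvalue_mono[OF _ \<nu>(3)]) simp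
  then show ?thesis using \<nu>(1,2) by blast
qed

text \<open>
  If the last lead is the top row, both state spaces are single points. Otherwise the two sets of
  positive eigenvalues have the same least element: the East eigenvalues are among those of the walk,
  by projecting to the last column, and each eigenvalue of the walk has an East eigenvalue below it.
\<close>

lemma T_rel_eq_east: "T_rel n cs = T_rel_East (last cs - 1)"
proof (cases "last cs - 1 = 0")
  case True
  have top: "lead (k - 1) = 0" using True cs_nonempty by (simp add: last_conv_nth lead_def)
  have "A = A'" if "A \<in> S" "A' \<in> S" for A A'
    by (rule state_eqI[OF that]) (use lead_mono[of _ "k - 1"] top in auto)
  then obtain A where "S = {A}" using states_nonempty by blast
  then show ?thesis
    using card_east_configs[of 0] True by (simp add: T_rel_def T_rel_East_def relaxation_time_def)
next
  case False
  define M where "M = last cs - 1"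
  have M: "lead (k - 1) = M" "M > 0"
    using False cs_nonempty by (simp_all add: last_conv_nth lead_def M_def)
  interpret column_sector n cs 0 "{k - 1}"
    by unfold_locales (use M cs_nonempty in \<open>auto simp: free_def\<close>)
  have height: "height = M" unfolding height_def last_col_def using M(1) by simp
  have two: "(1 :: nat) < 2 ^ M" using M(2) by (rule one_less_power[rotated]) simp
  have "2 ^ M \<le> card S"
    using card_image_le[OF finite_states, of spins]
    unfolding spins_surj card_east_configs height diff_zero .
  then have card: "card S \<noteq> 1" using two by linarith
  have card_east: "card (east_configs M) \<noteq> 1" unfolding card_east_configs using two by linarith
  have lap: "(\<lambda>f s. - matrix_walk_generator n f s) = walk.lap"
    "(\<lambda>f s. - east_generator M f s) = laplacian {1..M} east_flip"
    by (intro ext minus_walk_generator minus_east_generator)+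
  have "spectral_gap S (matrix_walk_generator n) = spectral_gap (east_configs M) (east_generator M)"
    unfolding spectral_gap_def lap
  proof (rule Least_eq_if_coinitial)
    show "0 < \<mu> \<and> eigenvalue_on S walk.lap \<mu>"
      if "0 < \<mu> \<and> eigenvalue_on (east_configs M) (laplacian {1..M} east_flip) \<mu>" for \<mu>
      using that east_eigenvalue_of_walk[of \<mu>] unfolding height diff_zero by blast
    show "\<exists>\<nu>. (0 < \<nu> \<and> eigenvalue_on (east_configs M) (laplacian {1..M} east_flip) \<nu>) \<and> \<nu> \<le> \<mu>"
      if "0 < \<mu> \<and> eigenvalue_on S walk.lap \<mu>" for \<mu>
      using east_eigenvalue_below_walk_eigenvalue that unfolding M_def by blast
  qed
  then show ?thesis
    using card card_east unfolding T_rel_def T_rel_East_def relaxation_time_def M_def[symmetric] by simp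
qed

end

theorem theorem1:
  fixes n :: nat
  assumes "1 \<le> n"
  shows "(\<forall>cs. cs \<noteq> [] \<and> sorted_wrt (<) cs \<and> set cs \<subseteq> {1..n}
            \<longrightarrow> T_rel n cs = T_rel_East (last cs - 1)) \<and>
         relaxation_time (unitriangular n) (matrix_walk_generator n) = T_rel_East (n - 1)"
proof
  have main: "T_rel n cs = T_rel_East (last cs - 1)"
    if "cs \<noteq> []" "sorted_wrt (<) cs" "set cs \<subseteq> {1..n}" for cs
  proof -
    interpret column_walk n cs using that by unfold_locales
    show ?thesis by (rule T_rel_eq_east)
  qed
  then show "\<forall>cs. cs \<noteq> [] \<and> sorted_wrt (<) cs \<and> set cs \<subseteq> {1..n}
            \<longrightarrow> T_rel n cs = T_rel_East (last cs - 1)" by blast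
  have "last [1..<Suc n] = n" using assms by simp
  moreover have "T_rel n [1..<Suc n] = T_rel_East (last [1..<Suc n] - 1)"
  proof (rule main)
    show "[1..<Suc n] \<noteq> []" using assms by simp
    show "sorted_wrt (<) [1..<Suc n]" by (rule sorted_wrt_upt)
    show "set [1..<Suc n] \<subseteq> {1..n}" by auto
  qed
  ultimately have "T_rel n [1..<Suc n] = T_rel_East (n - 1)" by (simp only:)
  then show "relaxation_time (unitriangular n) (matrix_walk_generator n) = T_rel_East (n - 1)"
    unfolding T_rel_def column_matrices_all .
qed

end
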